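(* Let $m\ge r\ge 1$ be integers, let $P$ be an $m\times m$ (Hermitian) positive definite complex matrix, and let $Z$ be an $m\times r$ random complex matrix with the matrix-variate complex central normal distribution $mN^{\mathbb{C}}(0,I_r,P)$. Define $H_Z=Z(\bar Z'Z)^{-1/2}\in V_{r,m}^{\mathbb{C}}$. Then $H_Z$ (which is said to have the complex matrix angular central Gaussian distribution with parameter $P$, written $H_Z\sim CMACG(P)$) has the density $$f_{H_Z}(H)=|P|^{-r}\,|\bar H'P^{-1}H|^{-m},\qquad H\in V_{r,m}^{\mathbb{C}},$$ with respect to the normalized invariant measure $[\mathrm{d}H]$ on $V_{r,m}^{\mathbb{C}}$.
   Context: $\bar X'$ denotes the conjugate transpose of a complex matrix $X$ and $|\cdot|$ the determinant. The complex Stiefel manifold is $V_{r,m}^{\mathbb{C}}=\{X\in\mathbb{C}^{m\times r}:\bar X'X=I_r\}$, $m\ge r$. The normalized invariant measure $[\mathrm{d}X]$ on $V_{r,m}^{\mathbb{C}}$ is the invariant measure of total mass one, i.e. the unique Borel probability measure invariant under $X\mapsto UXQ$ for all unitary $U\in\mathbb{C}^{m\times m}$, $Q\in\mathbb{C}^{r\times r}$. The distribution $mN^{\mathbb{C}}(0,I_r,P)$ is the distribution on $\mathbb{C}^{m\times r}$ with density $f_Z(Z)=\pi^{-mr}|P|^{-r}\exp[-\mathrm{tr}(\bar Z'P^{-1}Z)]$ with respect to Lebesgue measure $(\mathrm{d}Z)$ on $\mathbb{C}^{m\times r}\cong\mathbb{R}^{2mr}$. For a matrix $Z\in\mathbb{C}^{m\times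 r}$ of full column rank (which holds almost surely here), $(\bar Z'Z)^{-1/2}$ is the inverse of the Hermitian positive definite square root of $\bar Z'Z$, and $H_Z=Z(\bar Z'Z)^{-1/2}$ is called the orientation of $Z$. *)

theory Defs
  imports "HOL-Probability.Probability"
begin

text \<open>An element of \<^typ>\<open>complex ^ 'c ^ 'r\<close> is a matrix with rows indexed by \<^typ>\<open>'r\<close> and columns
  by \<^typ>\<open>'c\<close>. The measure \<^term>\<open>lborel\<close> on this type is Lebesgue measure under the identification
  of each complex entry with its pair of real and imaginary parts.\<close>

definition conj_transpose :: "complex ^ 'c ^ 'r \<Rightarrow> complex ^ 'r ^ 'c" where
  "conj_transpose X = (\<chi> i j. cnj (X $ j $ i))"

definition hermitian_matrix :: "complex ^ 'n ^ 'n \<Rightarrow> bool" where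
  "hermitian_matrix A \<longleftrightarrow> conj_transpose A = A"

text \<open>The quadratic form is real for Hermitian matrices, so taking its real part loses nothing.\<close>

definition hermitian_pos_def :: "complex ^ 'n ^ 'n \<Rightarrow> bool" where
  "hermitian_pos_def A \<longleftrightarrow> hermitian_matrix A \<and>
     (\<forall>x. x \<noteq> 0 \<longrightarrow> 0 < Re (\<Sum>i\<in>UNIV. cnj (x $ i) * (A *v x) $ i))"

definition hermitian_sqrt :: "complex ^ 'n ^ 'n \<Rightarrow> complex ^ 'n ^ 'n" where
  "hermitian_sqrt A = (THE B. hermitian_pos_def B \<and> B ** B = A)"

definition unitary_matrix :: "complex ^ 'n ^ 'n \<Rightarrow> bool" where
  "unitary_matrix U \<longleftrightarrow> conj_transpose U ** U = mat 1 \<and> U ** conj_transpose U = mat 1"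

definition stiefel :: "(complex ^ 'r ^ 'm) set" where
  "stiefel = {X. conj_transpose X ** X = mat 1}"

definition invariant_stiefel_prob :: "(complex ^ 'r ^ 'm) measure \<Rightarrow> bool" where
  "invariant_stiefel_prob \<mu> \<longleftrightarrow>
     prob_space \<mu> \<and> space \<mu> = stiefel \<and> sets \<mu> = sets (restrict_space borel stiefel) \<and>
     (\<forall>(U :: complex ^ 'm ^ 'm) (Q :: complex ^ 'r ^ 'r). unitary_matrix U \<longrightarrow> unitary_matrix Q \<longrightarrow>
        distr \<mu> \<mu> (\<lambda>X. U ** X ** Q) = \<mu>)"

definition stiefel_measure :: "(complex ^ 'r ^ 'm) measure" where
  "stiefel_measure = (THE \<mu>. invariant_stiefel_prob \<mu>)"

text \<open>The determinant and the trace below are real when \<^term>\<open>P\<close> is Hermitian positive definite.\<close>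

definition complex_normal_density ::
    "complex ^ 'm ^ 'm \<Rightarrow> complex ^ 'r ^ 'm \<Rightarrow> real" where
  "complex_normal_density P Z =
     inverse (pi ^ (CARD('m) * CARD('r))) * inverse (Re (det P) ^ CARD('r)) *
     exp (- Re (trace (conj_transpose Z ** matrix_inv P ** Z)))"

text \<open>Matrices without full column rank form a Lebesgue null set on which the orientation is not
  defined; there an arbitrary point of the manifold is used, so that the orientation is a
  manifold-valued function (the manifold is nonempty when there are at least as many rows as
  columns).\<close>

definition orientation :: "complex ^ 'r ^ 'm \<Rightarrow> complex ^ 'r ^ 'm" where
  "orientation Z =
     (if rank Z = CARD('r)
      then Z ** matrix_inv (hermitian_sqrt (conj_transpose Z ** Z))
      else (SOME X. X \<in> stiefel))"

text \<open>Both determinants are positive reals for \<^term>\<open>P\<close> Hermitian positive definite and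
  \<^term>\<open>H \<in> stiefel\<close>.\<close>

definition cmacg_density ::
    "complex ^ 'm ^ 'm \<Rightarrow> complex ^ 'r ^ 'm \<Rightarrow> real" where
  "cmacg_density P H =
     inverse (Re (det P) ^ CARD('r)) *
     inverse (Re (det (conj_transpose H ** matrix_inv P ** H)) ^ CARD('m))"

end

theory Submission
  imports Defs
begin

text \<open>
  Write \<open>H\<^sub>Z\<close> for the orientation of \<open>Z\<close> and \<open>X\<^sup>*\<close> for the conjugate transpose of \<open>X\<close>.

  The invariant probability measure of the manifold is the law of \<open>H\<^sub>Z\<close> for a standard
  Gaussian matrix \<open>Z\<close>. This law is invariant since \<open>H\<close> commutes with unitary multiplication on
  both sides and the Gaussian density depends on the norm only. It is the only
  invariant one by Haar averaging over the orientation of a Gaussian square matrix, because the unitary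
  group acts transitively (\<open>stiefel_measure_eq_orientation_law\<close>). Since the invariant measure is
  given by a definite description, existence and uniqueness are both needed before anything can be said
  about it.

  With \<open>P\<^sup>-\<^sup>1 = Q = S\<^sup>* S\<close> the density to be found is then a statement about two
  Gaussian integrals (\<open>orientation_change_of_covariance\<close>): for all \<open>f\<close>,
  \<open>\<integral> f(H\<^sub>Z) exp (- |S Z|\<^sup>2) dZ = \<integral> f(H\<^sub>Z) (det (Z\<^sup>* Z) / det (Z\<^sup>* Q Z))\<^sup>m exp (- |Z|\<^sup>2) dZ\<close>,
  where the ratio of determinants is \<open>det (H\<^sub>Z\<^sup>* Q H\<^sub>Z)\<^sup>-\<^sup>1\<close>.
  For \<open>f\<close> invariant under right multiplication by unitary matrices, \<open>det (Z\<^sup>* Q Z)\<^sup>-\<^sup>m\<close> is written as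
  a Gaussian integral of \<open>exp (- |S Z A|\<^sup>2) |det A|\<^sup>2\<^sup>m\<^sup>-\<^sup>2\<^sup>r\<close> over square matrices \<open>A\<close>. Taking
  \<open>Z A\<close> as the new variable, with Jacobian \<open>|det A|\<^sup>2\<^sup>m\<close>, produces \<open>exp (- |S Z|\<^sup>2)\<close>, and what
  remains of the integral over \<open>A\<close> cancels the other determinant. A general \<open>f\<close> is
  averaged over its right unitary translates, which affects neither side.

  Three tools are developed on the way: the Hermitian square root, obtained from
  invariance of domain together with its continuity, which gives measurability of the orientation
  (\<open>square_image_hermitian_pos_def\<close>); the Jacobian of right
  multiplication by a complex matrix, obtained from the multiplicativity of Jacobians and
  evaluated on diagonal matrices and shears (\<open>nn_integral_lborel_mult_right\<close>); and
  the fact that almost every matrix has full rank (\<open>AE_full_rank\<close>).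
\<close>

section \<open>Complex matrices\<close>

lemma conj_transpose_nth [simp]: "conj_transpose X $ i $ j = cnj (X $ j $ i)"
  by (simp add: conj_transpose_def)

lemma conj_transpose_conj_transpose [simp]: "conj_transpose (conj_transpose X) = X"
  by (simp add: vec_eq_iff)

lemma conj_transpose_mat_1 [simp]: "conj_transpose (mat 1) = mat 1"
  by (auto simp add: vec_eq_iff mat_def)

lemma conj_transpose_mult: "conj_transpose (X ** Y) = conj_transpose Y ** conj_transpose X"
  by (simp add: vec_eq_iff matrix_matrix_mult_def mult.commute)

lemma linear_conj_transpose: "linear conj_transpose"
  by (rule linearI) (simp_all add: vec_eq_iff)

lemmas conj_transpose_add = linear_add[OF linear_conj_transpose]
lemmas conj_transpose_diff = linear_diff[OF linear_conj_transpose]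
lemmas conj_transpose_scaleR = linear_scale[OF linear_conj_transpose]

lemma linear_matrix_mult_left: "linear (\<lambda>X. A ** X)" for A :: "complex ^ 'n ^ 'm"
  by (rule linearI)
     (simp_all add: vec_eq_iff matrix_matrix_mult_def sum.distrib algebra_simps scaleR_sum_right)

lemma linear_matrix_mult_right: "linear (\<lambda>X. X ** A)" for A :: "complex ^ 'n ^ 'm"
  by (rule linearI)
     (simp_all add: vec_eq_iff matrix_matrix_mult_def sum.distrib algebra_simps scaleR_sum_right)

lemmas matrix_mult_diff_left = linear_diff[OF linear_matrix_mult_right]
lemmas matrix_mult_diff_right = linear_diff[OF linear_matrix_mult_left]
lemmas matrix_mult_add_left = linear_add[OF linear_matrix_mult_right]
lemmas matrix_mult_add_right = linear_add[OF linear_matrix_mult_left]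
lemmas matrix_mult_scaleR_right = linear_scale[OF linear_matrix_mult_left]

lemma inner_complex_conv_cnj: "x \<bullet> y = Re (cnj x * y)"
  by (simp add: inner_complex_def)

text \<open>The real inner product of the Euclidean space \<^typ>\<open>complex ^ 'r ^ 'm\<close> is the real part of the
  Hermitian one. All quadratic forms below are written with it, which makes the theory of real
  Euclidean spaces (norms, isometries, Lebesgue measure) applicable to complex matrices.\<close>

lemma inner_matrix_conv_trace:
  "X \<bullet> Y = Re (trace (conj_transpose X ** Y))" for X Y :: "complex ^ 'r ^ 'm"
proof -
  have "X \<bullet> Y = (\<Sum>i\<in>UNIV. \<Sum>j\<in>UNIV. Re (cnj (X $ i $ j) * Y $ i $ j))"
    by (simp add: inner_vec_def inner_complex_conv_cnj)
  also have "\<dots> = (\<Sum>j\<in>UNIV. \<Sum>i\<in>UNIV. Re (cnj (X $ i $ j) * Y $ i $ j))"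
    by (rule sum.swap)
  finally show ?thesis
    by (simp add: trace_def matrix_matrix_mult_def)
qed

lemma norm_matrix_conv_trace:
  "(norm X)\<^sup>2 = Re (trace (conj_transpose X ** X))" for X :: "complex ^ 'r ^ 'm"
  by (simp flip: inner_matrix_conv_trace add: power2_norm_eq_inner)

lemma inner_mult_left_adjoint:
  "(A ** X) \<bullet> Y = X \<bullet> (conj_transpose A ** Y)" for X :: "complex ^ 'r ^ 'm"
  by (simp add: inner_matrix_conv_trace conj_transpose_mult matrix_mul_assoc)

lemma inner_mult_right_adjoint:
  "(X ** A) \<bullet> Y = X \<bullet> (Y ** conj_transpose A)" for X :: "complex ^ 'r ^ 'm"
  by (simp add: inner_matrix_conv_trace conj_transpose_mult matrix_mul_assoc trace_mul_sym[of "conj_transpose X ** Y"])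

lemma inner_conj_transpose: "conj_transpose X \<bullet> conj_transpose Y = X \<bullet> Y"
  for X Y :: "complex ^ 'r ^ 'm"
proof -
  have "conj_transpose X \<bullet> conj_transpose Y = Re (trace (conj_transpose Y ** X))"
    unfolding inner_matrix_conv_trace by (subst trace_mul_sym) simp
  also have "\<dots> = Y \<bullet> X"
    by (simp add: inner_matrix_conv_trace)
  finally show ?thesis
    by (simp add: inner_commute)
qed

lemma inner_matrix_vector_adjoint:
  "(A *v x) \<bullet> y = x \<bullet> (conj_transpose A *v y)" for A :: "complex ^ 'n ^ 'm"
proof -
  have "(A *v x) \<bullet> y = (\<Sum>i\<in>UNIV. \<Sum>j\<in>UNIV. Re (cnj (A $ i $ j * x $ j) * y $ i))"
    by (simp add: inner_vec_def inner_complex_conv_cnj matrix_vector_mult_def sum_distrib_right)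
  also have "\<dots> = (\<Sum>j\<in>UNIV. \<Sum>i\<in>UNIV. Re (cnj (A $ i $ j * x $ j) * y $ i))"
    by (rule sum.swap)
  also have "\<dots> = x \<bullet> (conj_transpose A *v y)"
    by (simp add: inner_vec_def inner_complex_conv_cnj matrix_vector_mult_def sum_distrib_left algebra_simps)
  finally show ?thesis .
qed

lemma inner_matrix_conv_columns: "X \<bullet> Y = (\<Sum>j\<in>UNIV. column j X \<bullet> column j Y)"
  for X Y :: "complex ^ 'r ^ 'm"
  unfolding inner_vec_def column_def by (subst sum.swap) simp

lemma column_matrix_mult: "column j (A ** X) = A *v column j X"
  by (simp add: column_def vec_eq_iff matrix_matrix_mult_def matrix_vector_mult_def)

lemma det_conj_transpose: "det (conj_transpose A) = cnj (det A)"
proof -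
  have "det (conj_transpose A) = det (\<chi> i j. cnj (A $ i $ j))"
    by (subst det_transpose[symmetric]) (simp add: transpose_def conj_transpose_def)
  also have "\<dots> = cnj (det A)"
    by (simp add: det_def)
  finally show ?thesis .
qed

lemma matrix_inv_mult:
  fixes A :: "'a::field ^ 'n ^ 'n"
  assumes "det A \<noteq> 0"
  shows "A ** matrix_inv A = mat 1" "matrix_inv A ** A = mat 1"
proof -
  have "\<exists>A'. A ** A' = mat 1 \<and> A' ** A = mat 1"
    using assms invertible_det_nz[of A] by (auto simp: invertible_def)
  from someI_ex[OF this] show "A ** matrix_inv A = mat 1" "matrix_inv A ** A = mat 1"
    by (auto simp: matrix_inv_def)
qed

lemma det_matrix_inv: "det (matrix_inv A) = inverse (det A)" if "det A \<noteq> 0"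
  for A :: "'a::field ^ 'n ^ 'n"
  using that matrix_inv_mult(1)[OF that] by (metis det_I det_mul inverse_unique)

lemma matrix_inv_eqI: "matrix_inv A = B" if "A ** B = mat 1" for A B :: "'a::field ^ 'n ^ 'n"
proof -
  have "det A \<noteq> 0"
    using that by (metis det_I det_mul mult_zero_left zero_neq_one)
  then show ?thesis
    using that by (metis matrix_inv_mult(2) matrix_mul_assoc matrix_mul_lid matrix_mul_rid)
qed

lemma conj_transpose_matrix_inv: "conj_transpose (matrix_inv A) = matrix_inv (conj_transpose A)"
  if "det A \<noteq> 0"
  by (rule matrix_inv_eqI[symmetric])
     (simp flip: conj_transpose_mult add: matrix_inv_mult[OF that])

lemma det_eq_0_iff_kernel: "det A = 0 \<longleftrightarrow> (\<exists>x. x \<noteq> 0 \<and> A *v x = 0)" for A :: "'a::field ^ 'n ^ 'n"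
  using invertible_det_nz[of A] matrix_left_invertible_ker[of A] invertible_left_inverse[of A] by auto

text \<open>Rank is row rank, so full column rank means that the rows span, which is the same as having a
  left inverse.\<close>

lemma rank_eq_card_iff_kernel:
  "rank Z = CARD('r) \<longleftrightarrow> (\<forall>x. Z *v x = 0 \<longrightarrow> x = 0)" for Z :: "'a::field ^ 'r ^ 'm"
proof -
  have "rank Z = CARD('r) \<longleftrightarrow> vec.span (rows Z) = UNIV"
    by (simp add: row_rank_def_gen vec.dim_eq_full[symmetric] card_cart_basis vec.dimension_def)
  then show ?thesis
    by (simp flip: matrix_left_invertible_ker add: matrix_left_invertible_span_rows_gen)
qed

lemma inner_vec_conv_cnj: "x \<bullet> y = Re (\<Sum>i\<in>UNIV. cnj (x $ i) * y $ i)" for x y :: "complex ^ 'n"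
  by (simp add: inner_vec_def inner_complex_conv_cnj)

section \<open>Hermitian positive definite matrices\<close>

lemma hermitian_pos_def_iff:
  "hermitian_pos_def A \<longleftrightarrow> conj_transpose A = A \<and> (\<forall>x. x \<noteq> 0 \<longrightarrow> 0 < x \<bullet> (A *v x))"
  unfolding hermitian_pos_def_def hermitian_matrix_def inner_vec_conv_cnj ..

lemma hermitian_pos_def_det_nz: "det A \<noteq> 0" if "hermitian_pos_def A"
  using that by (fastforce simp: hermitian_pos_def_iff det_eq_0_iff_kernel)

lemma hermitian_pos_def_mat_1: "hermitian_pos_def (mat 1)"
  by (simp add: hermitian_pos_def_iff)

lemma gram_hermitian_pos_def:
  fixes T :: "complex ^ 'r ^ 'm"
  assumes "rank T = CARD('r)" "hermitian_pos_def K"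
  shows "hermitian_pos_def (conj_transpose T ** K ** T)"
  unfolding hermitian_pos_def_iff
proof (intro conjI allI impI)
  show "conj_transpose (conj_transpose T ** K ** T) = conj_transpose T ** K ** T"
    using assms(2) by (simp add: hermitian_pos_def_iff conj_transpose_mult matrix_mul_assoc)
  fix x :: "complex ^ 'r" assume "x \<noteq> 0"
  then have "T *v x \<noteq> 0"
    using assms(1) by (auto simp: rank_eq_card_iff_kernel)
  then have "0 < (T *v x) \<bullet> (K *v (T *v x))"
    using assms(2) by (auto simp: hermitian_pos_def_iff)
  then show "0 < x \<bullet> (conj_transpose T ** K ** T *v x)"
    by (simp add: inner_matrix_vector_adjoint matrix_vector_mul_assoc matrix_mul_assoc)
qed

lemma rank_eq_card_iff_det: "rank A = CARD('n) \<longleftrightarrow> det A \<noteq> 0" for A :: "'a::field ^ 'n ^ 'n"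
  by (auto simp: rank_eq_card_iff_kernel det_eq_0_iff_kernel)

text \<open>The inner product of \<open>x\<close> with the image of \<open>x\<close> under the Gram matrix is the squared norm of
  \<^term>\<open>Z *v x\<close>.\<close>

lemma gram_kernel: "Z *v x = 0" if "(conj_transpose Z ** Z) *v x = 0" for Z :: "complex ^ 'r ^ 'm"
proof -
  have "(Z *v x) \<bullet> (Z *v x) = 0"
    using that by (simp add: inner_matrix_vector_adjoint matrix_vector_mul_assoc)
  then show ?thesis
    by simp
qed

lemma rank_eq_card_iff_det_gram:
  "rank Z = CARD('r) \<longleftrightarrow> det (conj_transpose Z ** Z) \<noteq> 0" for Z :: "complex ^ 'r ^ 'm"
  unfolding rank_eq_card_iff_kernel det_eq_0_iff_kernel
  by (metis gram_kernel matrix_vector_mul_assoc matrix_vector_mult_0_right)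

lemma hermitian_pos_def_matrix_inv: "hermitian_pos_def (matrix_inv A)" if "hermitian_pos_def A"
proof -
  have nz: "det A \<noteq> 0"
    using that by (rule hermitian_pos_def_det_nz)
  have herm: "conj_transpose A = A"
    using that by (simp add: hermitian_pos_def_iff)
  have "hermitian_pos_def (conj_transpose (matrix_inv A) ** A ** matrix_inv A)"
    using nz that by (intro gram_hermitian_pos_def) (simp_all add: rank_eq_card_iff_det det_matrix_inv)
  then show ?thesis
    using nz by (simp add: conj_transpose_matrix_inv herm matrix_inv_mult)
qed

text \<open>The inner product splits over the columns of \<^term>\<open>X\<close>, and each column contributes a value of the
  quadratic form of \<^term>\<open>B\<close>.\<close>

lemma hermitian_pos_def_inner_pos:
  fixes X :: "complex ^ 'r ^ 'm"
  assumes "hermitian_pos_def B"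
  shows "0 \<le> X \<bullet> (B ** X)" "X \<bullet> (B ** X) = 0 \<Longrightarrow> X = 0"
proof -
  have col: "0 \<le> x \<bullet> (B *v x)" for x
    using assms by (cases "x = 0") (auto simp: hermitian_pos_def_iff less_imp_le)
  then show "0 \<le> X \<bullet> (B ** X)"
    by (simp add: inner_matrix_conv_columns column_matrix_mult sum_nonneg)
  assume "X \<bullet> (B ** X) = 0"
  then have "\<forall>j. column j X \<bullet> (B *v column j X) = 0"
    using col by (simp add: inner_matrix_conv_columns column_matrix_mult sum_nonneg_eq_0_iff)
  then have "\<forall>j. column j X = 0"
    using assms by (metis hermitian_pos_def_iff less_irrefl)
  then show "X = 0"
    by (simp add: vec_eq_iff column_def)
qed

text \<open>With \<open>X = B - C\<close>, equality of the squares says \<open>B X + X C = 0\<close>. Taking the inner product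
  with \<open>X\<close> turns this into a vanishing sum of two nonnegative numbers, each of which forces \<open>X = 0\<close>.\<close>

lemma hermitian_pos_def_square_inj:
  assumes B: "hermitian_pos_def B" and C: "hermitian_pos_def C" and eq: "B ** B = C ** C"
  shows "B = C"
proof -
  define X where "X = B - C"
  have "B ** X + X ** C = 0"
    using eq by (simp add: X_def matrix_mult_diff_left matrix_mult_diff_right)
  then have "X \<bullet> (B ** X) + X \<bullet> (X ** C) = 0"
    by (metis inner_add_right inner_zero_right)
  moreover have "X \<bullet> (X ** C) = conj_transpose X \<bullet> (C ** conj_transpose X)"
    using C by (subst inner_conj_transpose[symmetric])
      (simp add: conj_transpose_mult hermitian_pos_def_iff)
  ultimately have "X \<bullet> (B ** X) = 0"
    using hermitian_pos_def_inner_pos(1)[OF B, of X]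
      hermitian_pos_def_inner_pos(1)[OF C, of "conj_transpose X"] by linarith
  then have "X = 0"
    using hermitian_pos_def_inner_pos(2)[OF B] by blast
  then show ?thesis
    by (simp add: X_def)
qed

section \<open>The Hermitian square root\<close>

lemma continuous_on_matrix_mult [continuous_intros]:
  fixes f :: "'a::topological_space \<Rightarrow> complex ^ 'n ^ 'm"
  assumes "continuous_on S f" "continuous_on S g"
  shows "continuous_on S (\<lambda>x. f x ** g x)"
  unfolding matrix_matrix_mult_def by (intro continuous_intros assms)

lemma continuous_on_conj_transpose [continuous_intros]:
  fixes f :: "'a::topological_space \<Rightarrow> complex ^ 'n ^ 'm"
  assumes "continuous_on S f"
  shows "continuous_on S (\<lambda>x. conj_transpose (f x))"
  unfolding conj_transpose_def by (intro continuous_intros assms)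

lemma continuous_on_det [continuous_intros]:
  fixes f :: "'a::topological_space \<Rightarrow> complex ^ 'n ^ 'n"
  assumes "continuous_on S f"
  shows "continuous_on S (\<lambda>x. det (f x))"
  unfolding det_def by (intro continuous_intros assms)

lemma continuous_on_matrix_vector_mult [continuous_intros]:
  fixes f :: "'a::topological_space \<Rightarrow> complex ^ 'n ^ 'm"
  assumes "continuous_on S f" "continuous_on S g"
  shows "continuous_on S (\<lambda>x. f x *v g x)"
  unfolding matrix_vector_mult_def by (intro continuous_intros assms)

text \<open>By compactness of the sphere: the complement is the projection of a closed set along a compact
  factor.\<close>

lemma open_pos_on_sphere:
  "open {A :: complex ^ 'n ^ 'n. \<forall>x\<in>sphere 0 1. 0 < x \<bullet> (A *v x)}" (is "open ?U")
proof -
  have "closed {z :: (complex ^ 'n) \<times> (complex ^ 'n ^ 'n). fst z \<bullet> (snd z *v fst z) \<le> (0::real)}"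
    by (intro closed_Collect_le continuous_intros)
  then have "closed {A :: complex ^ 'n ^ 'n. \<exists>x. x \<in> sphere 0 1 \<and> (x, A) \<in> {z. fst z \<bullet> (snd z *v fst z) \<le> 0}}"
    by (intro closed_compact_projection compact_sphere) auto
  also have "\<dots> = - ?U"
    by (fastforce simp: not_less)
  finally show ?thesis
    by (simp add: closed_def)
qed

lemma hermitian_pos_def_iff_sphere:
  fixes A :: "complex ^ 'n ^ 'n"
  shows "hermitian_pos_def A \<longleftrightarrow> conj_transpose A = A \<and> (\<forall>x\<in>sphere 0 1. 0 < x \<bullet> (A *v x))"
proof (safe)
  assume herm: "conj_transpose A = A" and pos: "\<forall>x\<in>sphere 0 1. 0 < x \<bullet> (A *v x)"
  show "hermitian_pos_def A"
    unfolding hermitian_pos_def_iff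
  proof (intro conjI allI impI herm)
    fix x :: "complex ^ 'n" assume x: "x \<noteq> 0"
    then have "0 < (x /\<^sub>R norm x) \<bullet> (A *v (x /\<^sub>R norm x))"
      using pos by (intro bspec[OF pos]) simp
    also have "\<dots> = (x \<bullet> (A *v x)) / (norm x)\<^sup>2"
      by (simp add: linear_scale[OF matrix_vector_mul_linear] power2_eq_square divide_inverse)
    finally show "0 < x \<bullet> (A *v x)"
      using x by (simp add: zero_less_divide_iff)
  qed
next
  assume *: "hermitian_pos_def A"
  then show "conj_transpose A = A"
    by (simp add: hermitian_pos_def_iff)
  fix x :: "complex ^ 'n"
  assume "x \<in> sphere 0 1"
  then have "x \<noteq> 0"
    by auto
  then show "0 < x \<bullet> (A *v x)"
    using * by (simp add: hermitian_pos_def_iff)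
qed

lemma openin_hermitian_pos_def:
  "openin (top_of_set {A. conj_transpose A = A}) {A. hermitian_pos_def A}"
proof -
  have "{A. hermitian_pos_def A} =
      {A. conj_transpose A = A} \<inter> {A :: complex ^ 'n ^ 'n. \<forall>x\<in>sphere 0 1. 0 < x \<bullet> (A *v x)}"
    by (auto simp: hermitian_pos_def_iff_sphere)
  then show ?thesis
    using open_pos_on_sphere by (auto simp: openin_open)
qed

text \<open>A zero \<open>x\<close> of a nonnegative quadratic form is a minimum, so the form has vanishing derivative at \<open>x\<close>
  in the direction \<open>y = A x\<close>; this derivative is twice the squared norm of \<open>y\<close>.\<close>

lemma semidefinite_kernel:
  fixes A :: "complex ^ 'n ^ 'n"
  assumes herm: "conj_transpose A = A" and nonneg: "\<And>x. 0 \<le> x \<bullet> (A *v x)"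
    and zero: "x \<bullet> (A *v x) = 0"
  shows "A *v x = 0"
proof -
  define y where "y = A *v x"
  define q where "q = y \<bullet> (A *v y)"
  have quad: "0 \<le> 2 * t * (y \<bullet> y) + t\<^sup>2 * q" for t
  proof -
    have "x \<bullet> (A *v y) = y \<bullet> y"
      using inner_matrix_vector_adjoint[of A x y] by (simp add: herm y_def inner_commute)
    then have "(x + t *\<^sub>R y) \<bullet> (A *v (x + t *\<^sub>R y)) = 2 * t * (y \<bullet> y) + t\<^sup>2 * q"
      using zero
      by (simp add: linear_scale[OF matrix_vector_mul_linear] linear_add[OF matrix_vector_mul_linear]
          inner_add_left inner_add_right q_def power2_eq_square algebra_simps flip: y_def)
    then show ?thesis
      using nonneg[of "x + t *\<^sub>R y"] by simp
  qed
  have "y \<bullet> y = 0"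
  proof (rule ccontr)
    assume "y \<bullet> y \<noteq> 0"
    then have pos: "0 < y \<bullet> y"
      by (simp add: order_less_le)
    have "0 \<le> q"
      unfolding q_def by (rule nonneg)
    \<comment> \<open>Small enough for the linear term to dominate; the summand one covers the case \<open>q = 0\<close>.\<close>
    define t where "t = - (y \<bullet> y) / (q + 1)"
    have "t < 0"
      using pos \<open>0 \<le> q\<close> by (simp add: t_def divide_neg_pos)
    moreover have "t * q \<ge> - (y \<bullet> y)"
      using pos \<open>0 \<le> q\<close> by (simp add: t_def field_simps)
    moreover have "0 < 2 * (y \<bullet> y) + t * q"
      using pos \<open>t * q \<ge> - (y \<bullet> y)\<close> by linarith
    ultimately have "t * (2 * (y \<bullet> y) + t * q) < 0"
      by (intro mult_neg_pos)
    with quad[of t] show False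
      by (simp add: power2_eq_square algebra_simps)
  qed
  then show ?thesis
    by (simp add: y_def)
qed

text \<open>Existence and continuity of the square root come from topology. Squaring is continuous and injective on the positive definite matrices, which form an open
  convex subset of the real vector space of Hermitian matrices; by invariance of domain it is an open
  map. Its image is also closed in the positive definite matrices, because \<open>tr (B\<^sup>2)\<close> is the squared
  norm of \<open>B\<close>: roots of a convergent sequence stay bounded, a limit point of them is
  semidefinite, and it is definite as soon as its square is invertible. Connectedness makes the
  image everything.\<close>

lemma square_image_hermitian_pos_def:
  "(\<lambda>B. B ** B) ` {B. hermitian_pos_def B} = {A :: complex ^ 'n ^ 'n. hermitian_pos_def A}"
    (is "?sq ` ?P = _")
  and openin_square_image:
  "openin (top_of_set {B. hermitian_pos_def B}) V \<Longrightarrow>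
     openin (top_of_set {A :: complex ^ 'n ^ 'n. hermitian_pos_def A}) ((\<lambda>B. B ** B) ` V)"
proof -
  let ?Herm = "{A :: complex ^ 'n ^ 'n. conj_transpose A = A}"
  have subP: "?P \<subseteq> ?Herm"
    by (auto simp: hermitian_pos_def_iff)
  have subsp: "subspace ?Herm"
    by (auto simp: subspace_def conj_transpose_add conj_transpose_scaleR linear_0[OF linear_conj_transpose])
  have sqP: "?sq ` ?P \<subseteq> ?P"
  proof safe
    fix B :: "complex ^ 'n ^ 'n" assume B: "hermitian_pos_def B"
    then have "hermitian_pos_def (conj_transpose B ** mat 1 ** B)"
      by (intro gram_hermitian_pos_def hermitian_pos_def_mat_1)
        (simp add: rank_eq_card_iff_det hermitian_pos_def_det_nz)
    then show "hermitian_pos_def (B ** B)"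
      using B by (simp add: hermitian_pos_def_iff)
  qed
  have opn: "openin (top_of_set ?P) (?sq ` V)" if V: "openin (top_of_set ?P) V" for V
  proof -
    have VP: "V \<subseteq> ?P"
      using V by (rule openin_imp_subset)
    have "openin (top_of_set ?Herm) (?sq ` V)"
    proof (rule invariance_of_domain_subspaces[OF _ subsp subsp])
      show "openin (top_of_set ?Herm) V"
        using openin_trans[OF V openin_hermitian_pos_def] .
      show "continuous_on V ?sq"
        by (intro continuous_intros)
      show "?sq \<in> V \<rightarrow> ?Herm"
        using VP sqP subP by blast
      show "inj_on ?sq V"
        using VP hermitian_pos_def_square_inj by (auto simp: inj_on_def)
    qed simp
    moreover have "?sq ` V \<subseteq> ?P"
      using VP sqP by blast
    ultimately show ?thesis
      using subP openin_subset_trans by blast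
  qed
  show "openin (top_of_set {A :: complex ^ 'n ^ 'n. hermitian_pos_def A}) (?sq ` V)"
    if "openin (top_of_set {B. hermitian_pos_def B}) V" for V
    using opn[OF that] .
  have closed: "closedin (top_of_set ?P) (?sq ` ?P)"
    unfolding closedin_limpt
  proof (intro conjI allI impI sqP)
    fix A assume A: "A islimpt ?sq ` ?P \<and> A \<in> ?P"
    then obtain f where f: "\<And>n. f n \<in> ?sq ` ?P" "f \<longlonglongrightarrow> A"
      by (auto simp: islimpt_sequential)
    then have "\<forall>n. \<exists>b. hermitian_pos_def b \<and> f n = b ** b"
      by blast
    then obtain b where b: "\<And>n. hermitian_pos_def (b n)" "\<And>n. f n = b n ** b n"
      by metis
    have "bounded (range b)"
    proof -
      have nb: "(norm (b n))\<^sup>2 = mat 1 \<bullet> f n" for n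
        using b(1)[of n] by (simp add: norm_matrix_conv_trace inner_matrix_conv_trace b(2) hermitian_pos_def_iff)
      have "bounded (range f)"
        using f(2) convergent_imp_bounded by blast
      then obtain M where M: "\<And>n. norm (f n) \<le> M"
        by (auto simp: bounded_iff)
      have "(norm (b n))\<^sup>2 \<le> norm (mat 1 :: complex ^ 'n ^ 'n) * M" for n
        unfolding nb using M[of n] by (intro order_trans[OF norm_cauchy_schwarz] mult_left_mono) auto
      then have "norm (b n) \<le> sqrt (norm (mat 1 :: complex ^ 'n ^ 'n) * M)" for n
        by (intro real_le_rsqrt)
      then show ?thesis
        by (auto simp: bounded_iff)
    qed
    then obtain B r where r: "strict_mono r" and lim: "(b \<circ> r) \<longlonglongrightarrow> B"
      using bounded_imp_convergent_subsequence by blast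
    have lim_fr: "(\<lambda>n. f (r n)) \<longlonglongrightarrow> A"
      using LIMSEQ_subseq_LIMSEQ[OF f(2) r] by (simp add: comp_def)
    have "continuous_on UNIV ?sq"
      by (intro continuous_intros)
    then have contsq: "isCont ?sq B"
      by (simp add: continuous_on_eq_continuous_at)
    have "(\<lambda>n. ?sq (b (r n))) \<longlonglongrightarrow> ?sq B"
      using isCont_tendsto_compose[OF contsq lim[unfolded comp_def]] .
    then have BB: "B ** B = A"
      using lim_fr b(2) LIMSEQ_unique by auto
    have herm: "conj_transpose B = B"
    proof -
      have "closed ?Herm"
        using subsp by (rule closed_subspace)
      moreover have "\<And>n. (b \<circ> r) n \<in> ?Herm"
        using b(1) by (auto simp: hermitian_pos_def_iff)
      ultimately show ?thesis
        using closed_sequentially[of ?Herm "b \<circ> r" B] lim by auto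
    qed
    have nonneg: "0 \<le> x \<bullet> (B *v x)" for x
    proof -
      have "closed {C. 0 \<le> x \<bullet> (C *v x)}"
        by (intro closed_Collect_le continuous_intros)
      moreover have "\<And>n. (b \<circ> r) n \<in> {C. 0 \<le> x \<bullet> (C *v x)}"
        using b(1) by (cases "x = 0") (auto simp: hermitian_pos_def_iff less_imp_le)
      ultimately show ?thesis
        using closed_sequentially[of _ "b \<circ> r" B] lim by blast
    qed
    have "det A \<noteq> 0"
      using A hermitian_pos_def_det_nz by auto
    then have "det B \<noteq> 0"
      by (auto simp flip: BB simp: det_mul)
    then have "hermitian_pos_def B"
      unfolding hermitian_pos_def_iff
    proof (intro conjI allI impI herm)
      fix x :: "complex ^ 'n" assume "x \<noteq> 0"
      then have "B *v x \<noteq> 0"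
        using \<open>det B \<noteq> 0\<close> by (auto simp: det_eq_0_iff_kernel)
      then have "x \<bullet> (B *v x) \<noteq> 0"
        using semidefinite_kernel[OF herm nonneg] by blast
      with nonneg[of x] show "0 < x \<bullet> (B *v x)"
        by linarith
    qed
    then show "A \<in> ?sq ` ?P"
      using BB by blast
  qed
  have "connected ?P"
  proof (intro convex_connected convexI CollectI)
    fix A B :: "complex ^ 'n ^ 'n" and u v :: real
    assume *: "A \<in> ?P" "B \<in> ?P" "0 \<le> u" "0 \<le> v" "u + v = 1"
    show "hermitian_pos_def (u *\<^sub>R A + v *\<^sub>R B)"
      unfolding hermitian_pos_def_iff
    proof (intro conjI allI impI)
      show "conj_transpose (u *\<^sub>R A + v *\<^sub>R B) = u *\<^sub>R A + v *\<^sub>R B"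
        using * by (simp add: conj_transpose_add conj_transpose_scaleR hermitian_pos_def_iff)
      fix x :: "complex ^ 'n" assume "x \<noteq> 0"
      then have "0 < x \<bullet> (A *v x)" "0 < x \<bullet> (B *v x)"
        using * by (auto simp: hermitian_pos_def_iff)
      then have "0 < u * (x \<bullet> (A *v x)) + v * (x \<bullet> (B *v x))"
        using * by (metis add_0 add_cancel_left_left add_nonneg_pos add_pos_nonneg mult_nonneg_nonneg
            mult_pos_pos order_less_le zero_neq_one)
      also have "\<dots> = x \<bullet> ((u *\<^sub>R A + v *\<^sub>R B) *v x)"
      proof -
        have "(u *\<^sub>R A + v *\<^sub>R B) *v x = u *\<^sub>R (A *v x) + v *\<^sub>R (B *v x)"
          by (simp add: vec_eq_iff matrix_vector_mult_def sum.distrib algebra_simps scaleR_sum_right)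
        then show ?thesis
          by (simp add: inner_add_right)
      qed
      finally show "0 < x \<bullet> ((u *\<^sub>R A + v *\<^sub>R B) *v x)" .
    qed
  qed
  moreover have "openin (top_of_set ?P) (?sq ` ?P)"
    by (intro opn) simp
  moreover have "?sq ` ?P \<noteq> {}"
    using hermitian_pos_def_mat_1 by blast
  ultimately show "?sq ` ?P = ?P"
    using closed by (auto simp: connected_clopen)
qed

lemma hermitian_sqrt_eqI: "hermitian_sqrt A = B" if "hermitian_pos_def B" "B ** B = A"
  unfolding hermitian_sqrt_def using that hermitian_pos_def_square_inj by blast

lemma hermitian_sqrt:
  assumes "hermitian_pos_def A"
  shows "hermitian_pos_def (hermitian_sqrt A)" "hermitian_sqrt A ** hermitian_sqrt A = A"
proof -
  have "A \<in> (\<lambda>B. B ** B) ` {B. hermitian_pos_def B}"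
    unfolding square_image_hermitian_pos_def using assms by simp
  then obtain B where "hermitian_pos_def B" "B ** B = A"
    by auto
  with hermitian_sqrt_eqI[OF this]
  show "hermitian_pos_def (hermitian_sqrt A)" "hermitian_sqrt A ** hermitian_sqrt A = A"
    by auto
qed

lemma continuous_on_hermitian_sqrt: "continuous_on {A. hermitian_pos_def A} hermitian_sqrt"
proof (rule continuous_on_inverse_open_map[OF _ square_image_hermitian_pos_def _ openin_square_image])
  show "continuous_on {B. hermitian_pos_def B} (\<lambda>B. B ** B)"
    by (intro continuous_intros)
qed (auto intro: hermitian_sqrt_eqI)

lemma conj_transpose_hermitian_sqrt: "conj_transpose (hermitian_sqrt A) = hermitian_sqrt A"
  if "hermitian_pos_def A"
  using hermitian_sqrt(1)[OF that] by (simp add: hermitian_pos_def_iff)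

lemma det_hermitian_sqrt_nz: "det (hermitian_sqrt A) \<noteq> 0" if "hermitian_pos_def A"
  using hermitian_sqrt(1)[OF that] by (rule hermitian_pos_def_det_nz)

text \<open>The determinant of the square root is real, because it equals its own conjugate, and nonzero.\<close>

lemma det_hermitian_pos_def:
  assumes "hermitian_pos_def A"
  shows "det A = of_real (Re (det A))" "0 < Re (det A)"
    "Re (det A) = (norm (det (hermitian_sqrt A)))\<^sup>2"
proof -
  let ?s = "det (hermitian_sqrt A)"
  have "det A = ?s * ?s"
    using hermitian_sqrt(2)[OF assms] by (metis det_mul)
  moreover have "cnj ?s = ?s"
    by (metis conj_transpose_hermitian_sqrt[OF assms] det_conj_transpose)
  ultimately have eq: "det A = of_real ((norm ?s)\<^sup>2)"
    by (metis complex_norm_square)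
  then show "det A = of_real (Re (det A))" "Re (det A) = (norm ?s)\<^sup>2"
    by auto
  then show "0 < Re (det A)"
    using det_hermitian_sqrt_nz[OF assms] by simp
qed

section \<open>Linear substitutions in Lebesgue integrals\<close>

lemma borel_measurable_matrix_mult [measurable]:
  fixes f :: "'a \<Rightarrow> complex ^ 'n ^ 'm" and g :: "'a \<Rightarrow> complex ^ 'r ^ 'n"
  assumes [measurable]: "f \<in> borel_measurable M" "g \<in> borel_measurable M"
  shows "(\<lambda>x. f x ** g x) \<in> borel_measurable M"
  by (rule borel_measurable_continuous_Pair) (auto intro!: continuous_intros)

lemma borel_measurable_det [measurable]:
  fixes f :: "'a \<Rightarrow> complex ^ 'n ^ 'n"
  assumes "f \<in> borel_measurable M"
  shows "(\<lambda>x. det (f x)) \<in> borel_measurable M"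
  by (rule borel_measurable_continuous_on[OF _ assms]) (auto intro!: continuous_intros)

lemma borel_measurable_conj_transpose [measurable]:
  fixes f :: "'a \<Rightarrow> complex ^ 'n ^ 'm"
  assumes "f \<in> borel_measurable M"
  shows "(\<lambda>x. conj_transpose (f x)) \<in> borel_measurable M"
  by (rule borel_measurable_continuous_on[OF _ assms]) (auto intro!: continuous_intros)

lemma borel_measurable_linear: "linear f \<Longrightarrow> f \<in> borel_measurable borel"
  for f :: "'a::euclidean_space \<Rightarrow> 'b::real_normed_vector"
  by (intro borel_measurable_continuous_onI linear_continuous_on linear_conv_bounded_linear[THEN iffD1])

lemma nn_integral_lborel_translate:
  fixes f :: "'a::euclidean_space \<Rightarrow> ennreal"
  assumes [measurable]: "f \<in> borel_measurable borel"
  shows "(\<integral>\<^sup>+x. f (a + x) \<partial>lborel) = (\<integral>\<^sup>+x. f x \<partial>lborel)"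
proof -
  have "(\<integral>\<^sup>+x. f x \<partial>lborel) = (\<integral>\<^sup>+x. f x \<partial>distr lborel borel ((+) a))"
    by (simp add: lborel_distr_plus)
  also have "\<dots> = (\<integral>\<^sup>+x. f (a + x) \<partial>lborel)"
    by (subst nn_integral_distr) simp_all
  finally show ?thesis ..
qed

lemma nn_integral_lborel_reflect:
  fixes f :: "'a::euclidean_space \<Rightarrow> ennreal"
  assumes [measurable]: "f \<in> borel_measurable borel"
  shows "(\<integral>\<^sup>+x. f (a - x) \<partial>lborel) = (\<integral>\<^sup>+x. f x \<partial>lborel)"
proof -
  have "(\<integral>\<^sup>+x. f x \<partial>lborel)
      = (\<integral>\<^sup>+x. f x \<partial>density (distr lborel borel (\<lambda>x. a + (- 1) *\<^sub>R x)) (\<lambda>_. 1))"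
    by (subst lborel_affine[of "-1" a]) simp_all
  also have "\<dots> = (\<integral>\<^sup>+x. f (a - x) \<partial>lborel)"
    by (simp add: density_1 nn_integral_distr)
  finally show ?thesis ..
qed

text \<open>A linear substitution multiplies every Lebesgue integral by the same constant. This is the usual
  Fubini argument for uniqueness of translation invariant measures, applied to \<open>f (T x + y) g y\<close>;
  evaluating the constant on one function \<open>g\<close> determines it, and here \<open>g\<close> will be a Gaussian.\<close>

lemma nn_integral_lborel_linear:
  fixes f g :: "'a::euclidean_space \<Rightarrow> ennreal"
  assumes [measurable]: "f \<in> borel_measurable borel" "g \<in> borel_measurable borel"
    and T: "linear T" and inv: "\<And>x. T (T' x) = x"
  shows "(\<integral>\<^sup>+x. f (T x) \<partial>lborel) * (\<integral>\<^sup>+x. g x \<partial>lborel)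
       = (\<integral>\<^sup>+x. f x \<partial>lborel) * (\<integral>\<^sup>+x. g (T x) \<partial>lborel)"
proof -
  note [measurable] = borel_measurable_linear[OF T]
  have "(\<integral>\<^sup>+x. f (T x) \<partial>lborel) * (\<integral>\<^sup>+y. g y \<partial>lborel)
      = (\<integral>\<^sup>+y. \<integral>\<^sup>+x. f (T x) * g y \<partial>lborel \<partial>lborel)"
    by (simp add: nn_integral_cmult nn_integral_multc)
  also have "\<dots> = (\<integral>\<^sup>+y. \<integral>\<^sup>+x. f (T x + y) * g y \<partial>lborel \<partial>lborel)"
  proof (rule nn_integral_cong)
    fix y
    have "(\<integral>\<^sup>+x. f (T x) * g y \<partial>lborel) = (\<integral>\<^sup>+x. f (T (T' y + x)) * g y \<partial>lborel)"
      by (rule nn_integral_lborel_translate[symmetric]) simp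
    then show "(\<integral>\<^sup>+x. f (T x) * g y \<partial>lborel) = (\<integral>\<^sup>+x. f (T x + y) * g y \<partial>lborel)"
      by (simp add: linear_add[OF T] inv add.commute)
  qed
  also have "\<dots> = (\<integral>\<^sup>+x. \<integral>\<^sup>+y. f (T x + y) * g y \<partial>lborel \<partial>lborel)"
    by (rule lborel_pair.Fubini') simp
  also have "\<dots> = (\<integral>\<^sup>+x. \<integral>\<^sup>+y. f y * g (y - T x) \<partial>lborel \<partial>lborel)"
  proof (rule nn_integral_cong)
    fix x
    show "(\<integral>\<^sup>+y. f (T x + y) * g y \<partial>lborel) = (\<integral>\<^sup>+y. f y * g (y - T x) \<partial>lborel)"
      by (subst nn_integral_lborel_translate[of "\<lambda>y. f y * g (y - T x)" "T x", symmetric]) simp_all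
  qed
  also have "\<dots> = (\<integral>\<^sup>+y. \<integral>\<^sup>+x. f y * g (y - T x) \<partial>lborel \<partial>lborel)"
    by (rule lborel_pair.Fubini') simp
  also have "\<dots> = (\<integral>\<^sup>+y. f y * (\<integral>\<^sup>+x. g (T x) \<partial>lborel) \<partial>lborel)"
  proof (rule nn_integral_cong)
    fix y
    have "(\<integral>\<^sup>+x. g (T x) \<partial>lborel) = (\<integral>\<^sup>+x. g (T (T' y - x)) \<partial>lborel)"
      by (rule nn_integral_lborel_reflect[symmetric]) simp
    then show "(\<integral>\<^sup>+x. f y * g (y - T x) \<partial>lborel) = f y * (\<integral>\<^sup>+x. g (T x) \<partial>lborel)"
      by (simp add: nn_integral_cmult linear_diff[OF T] inv)
  qed
  also have "\<dots> = (\<integral>\<^sup>+y. f y \<partial>lborel) * (\<integral>\<^sup>+x. g (T x) \<partial>lborel)"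
    by (simp add: nn_integral_multc)
  finally show ?thesis .
qed

lemma nn_integral_exp_square:
  assumes "0 < c"
  shows "(\<integral>\<^sup>+u. ennreal (exp (- (c * u)\<^sup>2)) \<partial>lborel) = ennreal (sqrt pi / c)"
proof -
  \<comment> \<open>The standard deviation for which the normal density is proportional to the integrand.\<close>
  define s where "s = 1 / (c * sqrt 2)"
  have s: "0 < s"
    using assms by (simp add: s_def)
  have eq: "normal_density 0 s u = (c / sqrt pi) * exp (- (c * u)\<^sup>2)" for u
    using assms by (simp add: normal_density_def s_def field_simps real_sqrt_mult real_sqrt_divide)
  have "emeasure (density lborel (normal_density 0 s)) UNIV = 1"
    using prob_space.emeasure_space_1[OF prob_space_normal_density[OF s, of 0]] by simp
  then have "1 = (\<integral>\<^sup>+u. ennreal (normal_density 0 s u) \<partial>lborel)"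
    by (simp add: emeasure_density)
  also have "\<dots> = ennreal (c / sqrt pi) * (\<integral>\<^sup>+u. ennreal (exp (- (c * u)\<^sup>2)) \<partial>lborel)"
    using assms unfolding eq by (subst nn_integral_cmult[symmetric]) (simp_all flip: ennreal_mult)
  finally have 1: "1 = ennreal (c / sqrt pi) * (\<integral>\<^sup>+u. ennreal (exp (- (c * u)\<^sup>2)) \<partial>lborel)" .
  have "ennreal (sqrt pi / c) = ennreal (sqrt pi / c) * ennreal (c / sqrt pi) * (\<integral>\<^sup>+u. ennreal (exp (- (c * u)\<^sup>2)) \<partial>lborel)"
    by (simp add: mult.assoc flip: 1)
  also have "ennreal (sqrt pi / c) * ennreal (c / sqrt pi) = 1"
    using assms by (simp flip: ennreal_mult)
  finally show ?thesis
    by simp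
qed

lemma nn_integral_gaussian_diagonal:
  fixes c :: "'a::euclidean_space \<Rightarrow> real"
  assumes c: "\<And>b. b \<in> Basis \<Longrightarrow> 0 < c b"
  shows "(\<integral>\<^sup>+x. ennreal (exp (- (\<Sum>b\<in>Basis. (c b * (x \<bullet> b))\<^sup>2))) \<partial>lborel) = ennreal (\<Prod>b\<in>Basis. sqrt pi / c b)"
proof -
  have "(\<integral>\<^sup>+x. ennreal (exp (- (\<Sum>b\<in>Basis. (c b * (x \<bullet> b))\<^sup>2))) \<partial>lborel)
      = (\<integral>\<^sup>+x. (\<Prod>b\<in>Basis. ennreal (exp (- (c b * (x \<bullet> b))\<^sup>2))) \<partial>lborel)"
    by (simp add: exp_sum prod_ennreal flip: sum_negf)
  also have "\<dots> = (\<Prod>b\<in>Basis. (\<integral>\<^sup>+u. ennreal (exp (- (c b * u)\<^sup>2)) \<partial>lborel))"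
    by (rule nn_integral_lborel_prod) simp_all
  also have "\<dots> = (\<Prod>b\<in>Basis. ennreal (sqrt pi / c b))"
    by (intro prod.cong refl nn_integral_exp_square c)
  also have "\<dots> = ennreal (\<Prod>b\<in>Basis. sqrt pi / c b)"
    using c by (intro prod_ennreal) (simp add: less_imp_le)
  finally show ?thesis .
qed

lemma nn_integral_gaussian_scaled:
  assumes "0 < c"
  shows "(\<integral>\<^sup>+x. ennreal (exp (- (c * norm (x::'a::euclidean_space))\<^sup>2)) \<partial>lborel) = ennreal ((sqrt pi / c) ^ DIM('a))"
proof -
  have "(c * norm x)\<^sup>2 = (\<Sum>b\<in>Basis. (c * (x \<bullet> b))\<^sup>2)" for x :: 'a
    by (simp add: power_mult_distrib power2_norm_eq_inner euclidean_inner[of x x] sum_distrib_left power2_eq_square[of "x \<bullet> _"])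
  then show ?thesis
    using nn_integral_gaussian_diagonal[of "\<lambda>_::'a. c"] assms by simp
qed

lemma nn_integral_gaussian:
  "(\<integral>\<^sup>+x. ennreal (exp (- (norm (x::'a::euclidean_space))\<^sup>2)) \<partial>lborel) = ennreal (sqrt pi ^ DIM('a))"
  using nn_integral_gaussian_scaled[of 1, where ?'a='a] by simp

lemma ennreal_mult_right_cancelD:
  assumes "a * G = b * G" "G \<noteq> 0" "G \<noteq> \<infinity>"
  shows "a = (b::ennreal)"
proof -
  have "a * G / G = b * G / G"
    using assms(1) by simp
  then show ?thesis
    using assms(2,3) by (simp add: ennreal_mult_divide_eq)
qed

lemma ennreal_divide_mult_self: "a / G * G = a" if "G \<noteq> 0" "G \<noteq> \<infinity>" for a G :: ennreal
  using that by (simp add: ennreal_divide_times ennreal_divide_self less_top)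

text \<open>An isometry fixes the Gaussian, so its constant is one.\<close>

lemma nn_integral_lborel_isometry:
  fixes f :: "'a::euclidean_space \<Rightarrow> ennreal" and T :: "'a \<Rightarrow> 'a"
  assumes "f \<in> borel_measurable borel" "linear T" "\<And>x. T (T' x) = x" "\<And>x. norm (T x) = norm x"
  shows "(\<integral>\<^sup>+x. f (T x) \<partial>lborel) = (\<integral>\<^sup>+x. f x \<partial>lborel)"
proof -
  define G where "G = (\<integral>\<^sup>+x. ennreal (exp (- (norm (x::'a))\<^sup>2)) \<partial>lborel)"
  have "G \<noteq> 0" "G \<noteq> \<infinity>"
    unfolding G_def nn_integral_gaussian by simp_all
  moreover have "(\<integral>\<^sup>+x. f (T x) \<partial>lborel) * G = (\<integral>\<^sup>+x. f x \<partial>lborel) * G"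
    using nn_integral_lborel_linear[OF assms(1) _ assms(2,3), of "\<lambda>x. ennreal (exp (- (norm x)\<^sup>2))"]
    unfolding assms(4) G_def by simp
  ultimately show ?thesis
    by (blast intro: ennreal_mult_right_cancelD)
qed

text \<open>The coordinates of a complex matrix are the real and imaginary parts of its entries.\<close>

lemma bij_betw_matrix_Basis:
  "bij_betw (\<lambda>(i, j, u). axis i (axis j u)) (UNIV \<times> UNIV \<times> Basis) (Basis :: (complex ^ 'r::finite ^ 'm::finite) set)"
proof -
  have "(0::complex) \<notin> Basis" "(0::complex ^ 'r) \<notin> Basis"
    by simp_all
  then have "inj_on (\<lambda>(i, j, u). axis i (axis j u) :: complex ^ 'r ^ 'm) (UNIV \<times> UNIV \<times> Basis)"
    by (auto simp: inj_on_def axis_eq_axis)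
  moreover have "(\<lambda>(i, j, u). axis i (axis j u)) ` (UNIV \<times> UNIV \<times> Basis) = (Basis :: (complex ^ 'r ^ 'm) set)"
    by (fastforce simp: Basis_vec_def image_iff)
  ultimately show ?thesis
    by (simp add: bij_betw_def)
qed

text \<open>Multiplication by a diagonal matrix scales each real coordinate, so the Gaussian integral still
  factorizes; each diagonal entry scales two real coordinates in each of the rows.\<close>

lemma nn_integral_gaussian_mult_diagonal:
  fixes d :: "'r::finite \<Rightarrow> complex"
  assumes d: "\<And>k. d k \<noteq> 0"
  shows "(\<integral>\<^sup>+Z. ennreal (exp (- (norm ((Z :: complex ^ 'r ^ 'm::finite) ** (\<chi> i k. if i = k then d k else 0)))\<^sup>2)) \<partial>lborel)
     = ennreal (1 / norm (\<Prod>k\<in>UNIV. d k) ^ (2 * CARD('m))) * ennreal (sqrt pi ^ DIM(complex ^ 'r ^ 'm))"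
proof -
  let ?D = "\<chi> i k. if i = k then d k else 0"
  define c :: "complex ^ 'r ^ 'm \<Rightarrow> real" where
    "c b = (\<Sum>i\<in>UNIV. \<Sum>k\<in>UNIV. norm (d k) * norm (b $ i $ k))" for b
  have c_axis: "c (axis i (axis k u)) = norm (d k) * norm u" for i k and u :: complex
  proof -
    have "c (axis i (axis k u)) = (\<Sum>i'\<in>UNIV. if i' = i then (\<Sum>k'\<in>UNIV. if k' = k then norm (d k) * norm u else 0) else 0)"
      unfolding c_def by (rule sum.cong[OF refl]) (auto simp: axis_def intro!: sum.cong simp del: sum.delta sum.delta')
    then show ?thesis
      by simp
  qed
  have c_pos: "0 < c b" if "b \<in> Basis" for b
    using that d by (auto simp: Basis_vec_def c_axis Basis_complex_def)
  have "(norm (Z ** ?D))\<^sup>2 = (\<Sum>b\<in>Basis. (c b * (Z \<bullet> b))\<^sup>2)" for Z :: "complex ^ 'r ^ 'm"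
  proof -
    have "(norm (Z ** ?D))\<^sup>2 = (\<Sum>i\<in>UNIV. \<Sum>k\<in>UNIV. (norm (Z $ i $ k * d k))\<^sup>2)"
      by (simp add: power2_norm_eq_inner inner_vec_def matrix_matrix_mult_def if_distrib[where f="(*) _"] cong: if_cong)
    also have "\<dots> = (\<Sum>i\<in>UNIV. \<Sum>k\<in>UNIV. \<Sum>u\<in>Basis. (norm (d k) * (Z $ i $ k \<bullet> u))\<^sup>2)"
      by (simp add: norm_mult power_mult_distrib Basis_complex_def cmod_power2 algebra_simps)
    also have "\<dots> = (\<Sum>(i, k, u)\<in>UNIV \<times> UNIV \<times> Basis. (norm (d k) * (Z $ i $ k \<bullet> u))\<^sup>2)"
      by (simp add: sum.cartesian_product)
    also have "\<dots> = (\<Sum>p\<in>UNIV \<times> UNIV \<times> Basis. (\<lambda>b. (c b * (Z \<bullet> b))\<^sup>2) ((\<lambda>(i, j, u). axis i (axis j u)) p))"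
      by (intro sum.cong) (auto simp: c_axis inner_axis)
    also have "\<dots> = (\<Sum>b\<in>Basis. (c b * (Z \<bullet> b))\<^sup>2)"
      by (rule sum.reindex_bij_betw[OF bij_betw_matrix_Basis])
    finally show ?thesis .
  qed
  then have "(\<integral>\<^sup>+Z. ennreal (exp (- (norm ((Z :: complex ^ 'r ^ 'm) ** ?D))\<^sup>2)) \<partial>lborel)
      = ennreal (\<Prod>b\<in>Basis. sqrt pi / c b)"
    using nn_integral_gaussian_diagonal[of c] c_pos by simp
  also have "(\<Prod>b\<in>Basis. sqrt pi / c b) = sqrt pi ^ DIM(complex ^ 'r ^ 'm) / (\<Prod>b\<in>Basis. c b)"
    by (simp add: prod_dividef)
  also have "(\<Prod>b\<in>Basis. c b) = (\<Prod>p\<in>UNIV \<times> UNIV \<times> Basis. c ((\<lambda>(i, j, u). axis i (axis j u)) p))"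
    by (rule prod.reindex_bij_betw[OF bij_betw_matrix_Basis, symmetric])
  also have "\<dots> = (\<Prod>(i::'m, k, u::complex)\<in>UNIV \<times> UNIV \<times> Basis. norm (d k))"
    by (intro prod.cong) (auto simp: c_axis)
  also have "\<dots> = (\<Prod>i\<in>(UNIV::'m set). \<Prod>k\<in>UNIV. \<Prod>u\<in>(Basis::complex set). norm (d k))"
    by (simp only: prod.cartesian_product)
  also have "\<dots> = norm (\<Prod>k\<in>UNIV. d k) ^ (2 * CARD('m))"
    by (simp add: prod_power_distrib flip: prod_norm power_mult)
  finally show ?thesis
    by (simp flip: ennreal_mult)
qed

text \<open>The type argument records the number of rows of the matrices \<open>Z\<close>, which is not visible in \<open>A\<close> and
  determines the exponent.\<close>

definition right_mult_law :: "'m::finite itself \<Rightarrow> complex ^ 'r ^ 'r \<Rightarrow> bool" where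
  "right_mult_law _ A \<longleftrightarrow> det A \<noteq> 0 \<and> (\<forall>f :: complex ^ 'r ^ 'm \<Rightarrow> ennreal. f \<in> borel_measurable borel \<longrightarrow>
     (\<integral>\<^sup>+Z. f (Z ** A) \<partial>lborel) = ennreal (1 / norm (det A) ^ (2 * CARD('m))) * (\<integral>\<^sup>+Z. f Z \<partial>lborel))"

lemma right_mult_law_mult:
  fixes A B :: "complex ^ 'r ^ 'r"
  assumes A: "right_mult_law TYPE('m) A" and B: "right_mult_law TYPE('m) B"
  shows "right_mult_law TYPE('m::finite) (A ** B)"
  unfolding right_mult_law_def
proof (intro conjI allI impI)
  show "det (A ** B) \<noteq> 0"
    using A B by (simp add: right_mult_law_def det_mul)
  fix f :: "complex ^ 'r ^ 'm \<Rightarrow> ennreal"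
  assume [measurable]: "f \<in> borel_measurable borel"
  have law_A: "(\<integral>\<^sup>+Z. g (Z ** A) \<partial>lborel) = ennreal (1 / norm (det A) ^ (2 * CARD('m))) * (\<integral>\<^sup>+Z. g Z \<partial>lborel)"
    if "g \<in> borel_measurable borel" for g :: "complex ^ 'r ^ 'm \<Rightarrow> ennreal"
    using A that by (simp add: right_mult_law_def)
  have "(\<integral>\<^sup>+Z. f (Z ** (A ** B)) \<partial>lborel) = (\<integral>\<^sup>+Z. f (Z ** A ** B) \<partial>lborel)"
    by (simp add: matrix_mul_assoc)
  also have "\<dots> = ennreal (1 / norm (det A) ^ (2 * CARD('m))) * (\<integral>\<^sup>+Z. f (Z ** B) \<partial>lborel)"
    by (rule law_A[of "\<lambda>Z. f (Z ** B)"]) simp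
  also have "(\<integral>\<^sup>+Z. f (Z ** B) \<partial>lborel) = ennreal (1 / norm (det B) ^ (2 * CARD('m))) * (\<integral>\<^sup>+Z. f Z \<partial>lborel)"
    using B by (simp add: right_mult_law_def)
  also have "ennreal (1 / norm (det A) ^ (2 * CARD('m))) * (ennreal (1 / norm (det B) ^ (2 * CARD('m))) * (\<integral>\<^sup>+Z. f Z \<partial>lborel))
      = ennreal (1 / norm (det (A ** B)) ^ (2 * CARD('m))) * (\<integral>\<^sup>+Z. f Z \<partial>lborel)"
    by (simp add: det_mul norm_mult power_mult_distrib mult.assoc[symmetric] flip: ennreal_mult)
  finally show "(\<integral>\<^sup>+Z. f (Z ** (A ** B)) \<partial>lborel) =
      ennreal (1 / norm (det (A ** B)) ^ (2 * CARD('m))) * (\<integral>\<^sup>+Z. f Z \<partial>lborel)" .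
qed

lemma right_mult_constant:
  fixes A :: "complex ^ 'r ^ 'r"
  assumes "det A \<noteq> 0"
  obtains c :: ennreal where
    "\<And>f :: complex ^ 'r ^ 'm \<Rightarrow> ennreal. f \<in> borel_measurable borel \<Longrightarrow>
      (\<integral>\<^sup>+Z. f (Z ** A) \<partial>lborel) = c * (\<integral>\<^sup>+Z. f Z \<partial>lborel)"
    "c * ennreal (sqrt pi ^ DIM(complex ^ 'r ^ 'm))
      = (\<integral>\<^sup>+Z. ennreal (exp (- (norm ((Z :: complex ^ 'r ^ 'm) ** A))\<^sup>2)) \<partial>lborel)"
proof
  define G where "G = (\<integral>\<^sup>+x. ennreal (exp (- (norm (x::complex ^ 'r ^ 'm))\<^sup>2)) \<partial>lborel)"
  have G: "G \<noteq> 0" "G \<noteq> \<infinity>"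
    unfolding G_def nn_integral_gaussian by simp_all
  let ?GA = "\<integral>\<^sup>+Z. ennreal (exp (- (norm ((Z :: complex ^ 'r ^ 'm) ** A))\<^sup>2)) \<partial>lborel"
  show "?GA / G * ennreal (sqrt pi ^ DIM(complex ^ 'r ^ 'm)) = ?GA"
    using ennreal_divide_mult_self[OF G, of ?GA] unfolding G_def nn_integral_gaussian .
  fix f :: "complex ^ 'r ^ 'm \<Rightarrow> ennreal"
  assume f: "f \<in> borel_measurable borel"
  have "(\<integral>\<^sup>+Z. f (Z ** A) \<partial>lborel) * G = (\<integral>\<^sup>+Z. f Z \<partial>lborel) * ?GA"
    unfolding G_def
    by (rule nn_integral_lborel_linear[OF f _ linear_matrix_mult_right, where T'="\<lambda>Z. Z ** matrix_inv A"])
      (simp_all add: matrix_inv_mult[OF assms] flip: matrix_mul_assoc)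
  also have "\<dots> = (\<integral>\<^sup>+Z. f Z \<partial>lborel) * (?GA / G * G)"
    by (simp only: ennreal_divide_mult_self[OF G])
  also have "\<dots> = ?GA / G * (\<integral>\<^sup>+Z. f Z \<partial>lborel) * G"
    by (simp only: ac_simps)
  finally show "(\<integral>\<^sup>+Z. f (Z ** A) \<partial>lborel) = ?GA / G * (\<integral>\<^sup>+Z. f Z \<partial>lborel)"
    using G by (rule ennreal_mult_right_cancelD)
qed

lemma right_mult_law_diagonal:
  fixes d :: "'r::finite \<Rightarrow> complex"
  assumes d: "\<And>k. d k \<noteq> 0"
  shows "right_mult_law TYPE('m::finite) (\<chi> i k. if i = k then d k else 0)" (is "right_mult_law _ ?D")
proof -
  have det: "det ?D = (\<Prod>k\<in>UNIV. d k)"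
    by (subst det_diagonal) simp_all
  then have nz: "det ?D \<noteq> 0"
    using d by simp
  obtain c where c: "\<And>f :: complex ^ 'r ^ 'm \<Rightarrow> ennreal. f \<in> borel_measurable borel \<Longrightarrow>
      (\<integral>\<^sup>+Z. f (Z ** ?D) \<partial>lborel) = c * (\<integral>\<^sup>+Z. f Z \<partial>lborel)"
    "c * ennreal (sqrt pi ^ DIM(complex ^ 'r ^ 'm))
      = (\<integral>\<^sup>+Z. ennreal (exp (- (norm ((Z :: complex ^ 'r ^ 'm) ** ?D))\<^sup>2)) \<partial>lborel)"
    by (rule right_mult_constant[OF nz, where ?'m='m]) (rule that)
  have "c * ennreal (sqrt pi ^ DIM(complex ^ 'r ^ 'm)) =
      ennreal (1 / norm (det ?D) ^ (2 * CARD('m))) * ennreal (sqrt pi ^ DIM(complex ^ 'r ^ 'm))"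
    using c(2) nn_integral_gaussian_mult_diagonal[OF d, where ?'m='m] by (simp add: det)
  moreover have "ennreal (sqrt pi ^ DIM(complex ^ 'r ^ 'm)) \<noteq> 0" "ennreal (sqrt pi ^ DIM(complex ^ 'r ^ 'm)) \<noteq> \<infinity>"
    by simp_all
  ultimately have "c = ennreal (1 / norm (det ?D) ^ (2 * CARD('m)))"
    by (blast intro: ennreal_mult_right_cancelD)
  then show ?thesis
    using c(1) nz by (simp add: right_mult_law_def)
qed

definition replace_row :: "'n::finite \<Rightarrow> complex ^ 'n \<Rightarrow> complex ^ 'n ^ 'n" where
  "replace_row j a = (\<chi> i. if i = j then a else axis i 1)"

lemma matrix_mult_row: "(A ** B) $ i = (\<Sum>k\<in>UNIV. A $ i $ k *s B $ k)" for A :: "'a::semiring_1 ^ 'n ^ 'm"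
  by (simp add: vec_eq_iff matrix_matrix_mult_def)

lemma mat_1_row: "mat 1 $ i = axis i (1::'a::semiring_1)"
  by (simp add: vec_eq_iff mat_def axis_def) 

lemma replace_row_mult_row:
  "(A ** replace_row j a) $ i = A $ i + A $ i $ j *s (a - axis j 1)"
proof -
  have "(A ** replace_row j a) $ i = (\<Sum>k\<in>UNIV. A $ i $ k *s mat 1 $ k + (if k = j then A $ i $ k *s (a - axis k 1) else 0))"
    unfolding matrix_mult_row
    by (intro sum.cong) (auto simp: replace_row_def vec_eq_iff mat_1_row algebra_simps)
  also have "\<dots> = (A ** mat 1) $ i + A $ i $ j *s (a - axis j 1)"
    unfolding sum.distrib matrix_mult_row by simp
  finally show ?thesis
    by simp
qed

lemma replace_row_shear_mult:
  assumes "a $ j = 1" "b $ j = 1"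
  shows "replace_row j a ** replace_row j b = replace_row j (a + b - axis j 1)"
  unfolding vec_eq_iff[of "_ ** _"]
  by (simp add: replace_row_mult_row) (auto simp: replace_row_def assms axis_def vec_eq_iff)

text \<open>A shear \<open>E\<close> is conjugate to its own square by a diagonal matrix. Hence its constant \<open>c\<close> and
  its determinant satisfy \<open>c\<^sup>2 = c\<close> and \<open>det E\<^sup>2 = det E\<close>, and invertibility leaves only the value one.\<close>

lemma right_mult_law_shear:
  fixes a :: "complex ^ 'n"
  assumes a: "a $ j = 1"
  shows "right_mult_law TYPE('m::finite) (replace_row j a)" "det (replace_row j a) = 1"
proof -
  define D where "D t = (\<chi> i k. if i = k then (if k = j then t else 1) else 0 :: complex ^ 'n ^ 'n)" for t
  define b where "b = 2 *s axis j 1 - a"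
  have b: "b $ j = 1"
    by (simp add: b_def a)
  have inv: "replace_row j a ** replace_row j b = mat 1" "replace_row j b ** replace_row j a = mat 1"
  proof -
    have "a + b - axis j 1 = axis j 1"
      by (simp add: b_def vec_eq_iff)
    moreover have "replace_row j (axis j 1) = mat 1"
      by (auto simp: replace_row_def vec_eq_iff mat_1_row)
    ultimately show "replace_row j a ** replace_row j b = mat 1" "replace_row j b ** replace_row j a = mat 1"
      by (simp_all add: replace_row_shear_mult a b add.commute)
  qed
  have square: "replace_row j a ** replace_row j a = D 2 ** replace_row j a ** D (1 / 2)"
    unfolding replace_row_shear_mult[OF a a]
    by (simp add: vec_eq_iff D_def matrix_matrix_mult_def if_distrib[where f="\<lambda>x. x * _"] if_distrib[where f="(*) _"] cong: if_cong)
      (auto simp: replace_row_def axis_def a)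
  have detD: "det (D t) = t" for t
    by (simp add: D_def det_diagonal)
  have lawD: "right_mult_law TYPE('m) (D t)" if "t \<noteq> 0" for t
    unfolding D_def by (rule right_mult_law_diagonal) (simp add: that)
  have nz: "det (replace_row j a) \<noteq> 0" "det (replace_row j b) \<noteq> 0"
    using inv by (metis det_I det_mul mult_zero_left mult_zero_right zero_neq_one)+
  have "det (replace_row j a) * det (replace_row j a) = det (replace_row j a)"
    using arg_cong[OF square, of det] by (simp add: det_mul detD)
  then show det: "det (replace_row j a) = 1"
    using nz by simp
  obtain c where c: "\<And>f :: complex ^ 'n ^ 'm \<Rightarrow> ennreal. f \<in> borel_measurable borel \<Longrightarrow>
      (\<integral>\<^sup>+Z. f (Z ** replace_row j a) \<partial>lborel) = c * (\<integral>\<^sup>+Z. f Z \<partial>lborel)"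
    by (rule right_mult_constant[OF nz(1), where ?'m='m]) (rule that)
  obtain c' where c': "\<And>f :: complex ^ 'n ^ 'm \<Rightarrow> ennreal. f \<in> borel_measurable borel \<Longrightarrow>
      (\<integral>\<^sup>+Z. f (Z ** replace_row j b) \<partial>lborel) = c' * (\<integral>\<^sup>+Z. f Z \<partial>lborel)"
    by (rule right_mult_constant[OF nz(2), where ?'m='m]) (rule that)
  define g :: "complex ^ 'n ^ 'm \<Rightarrow> ennreal" where "g Z = ennreal (exp (- (norm Z)\<^sup>2))" for Z
  define G where "G = (\<integral>\<^sup>+Z. g Z \<partial>lborel)"
  have G: "G \<noteq> 0" "G \<noteq> \<infinity>"
    unfolding G_def g_def nn_integral_gaussian by simp_all
  have [measurable]: "g \<in> borel_measurable borel"
    unfolding g_def by measurable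
  have "G = (\<integral>\<^sup>+Z. g (Z ** replace_row j a ** replace_row j b) \<partial>lborel)"
    by (simp add: G_def inv flip: matrix_mul_assoc)
  also have "\<dots> = c * (c' * G)"
    by (simp add: c[of "\<lambda>Z. g (Z ** replace_row j b)"] c' G_def)
  finally have cc': "(c * c') * G = 1 * G"
    by (simp add: mult.assoc)
  then have "c * c' = 1"
    using G by (blast intro: ennreal_mult_right_cancelD)
  then have c_finite: "c \<noteq> 0" "c \<noteq> \<infinity>"
    by (auto simp: ennreal_top_mult split: if_splits)
  have "c * (c * G) = (\<integral>\<^sup>+Z. g (Z ** replace_row j a ** replace_row j a) \<partial>lborel)"
    by (simp add: c[of "\<lambda>Z. g (Z ** replace_row j a)"] c G_def)
  also have "\<dots> = (\<integral>\<^sup>+Z. g (Z ** D 2 ** replace_row j a ** D (1 / 2)) \<partial>lborel)"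
    using square by (metis (no_types, lifting) matrix_mul_assoc)
  also have "\<dots> = ennreal (1 / 2 ^ (2 * CARD('m))) * (\<integral>\<^sup>+Z. g (Z ** replace_row j a ** D (1 / 2)) \<partial>lborel)"
  proof -
    have "(\<integral>\<^sup>+Z. h (Z ** D 2) \<partial>lborel) = ennreal (1 / 2 ^ (2 * CARD('m))) * (\<integral>\<^sup>+Z. h Z \<partial>lborel)"
      if "h \<in> borel_measurable borel" for h :: "complex ^ 'n ^ 'm \<Rightarrow> ennreal"
      using lawD[of 2] that by (simp add: right_mult_law_def detD)
    from this[of "\<lambda>Z. g (Z ** replace_row j a ** D (1 / 2))"] show ?thesis
      by simp
  qed
  also have "(\<integral>\<^sup>+Z. g (Z ** replace_row j a ** D (1 / 2)) \<partial>lborel) = c * (\<integral>\<^sup>+Z. g (Z ** D (1 / 2)) \<partial>lborel)"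
    by (simp add: c[of "\<lambda>Z. g (Z ** D (1/2))"])
  also have "(\<integral>\<^sup>+Z. g (Z ** D (1 / 2)) \<partial>lborel) = ennreal (2 ^ (2 * CARD('m))) * G"
    using lawD[of "1/2"] by (simp add: right_mult_law_def detD G_def power_divide norm_divide)
  also have "ennreal (1 / 2 ^ (2 * CARD('m))) * (c * (ennreal (2 ^ (2 * CARD('m))) * G))
      = (ennreal (1 / 2 ^ (2 * CARD('m))) * ennreal (2 ^ (2 * CARD('m)))) * (c * G)"
    by (simp add: ac_simps)
  also have "ennreal (1 / 2 ^ (2 * CARD('m))) * ennreal (2 ^ (2 * CARD('m))) = 1"
    by (simp flip: ennreal_mult)
  finally have "c * (c * G) = 1 * (c * G)" .
  moreover have "c * G \<noteq> 0" "c * G \<noteq> \<infinity>"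
    using c_finite G by (auto simp: ennreal_mult_eq_top_iff)
  ultimately have "c = 1"
    by (blast intro: ennreal_mult_right_cancelD)
  then show "right_mult_law TYPE('m) (replace_row j a)"
    using c nz det by (simp add: right_mult_law_def)
qed

lemma right_mult_law_replace_row:
  fixes a :: "complex ^ 'n"
  assumes a: "a $ j \<noteq> 0"
  shows "right_mult_law TYPE('m::finite) (replace_row j a)"
proof -
  let ?D = "(\<chi> i k. if i = k then (if k = j then a $ j else 1) else 0 :: complex ^ 'n ^ 'n)"
  define s where "s = inverse (a $ j) *s a"
  have s: "s $ j = 1"
    using a by (simp add: s_def)
  have split: "replace_row j a = ?D ** replace_row j s"
    using a by (simp add: vec_eq_iff matrix_matrix_mult_def if_distrib[where f="\<lambda>x. x * _"] cong: if_cong)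
      (auto simp: replace_row_def axis_def s_def)
  have "right_mult_law TYPE('m) ?D"
    by (rule right_mult_law_diagonal) (simp add: a)
  from right_mult_law_mult[OF this right_mult_law_shear(1)[OF s]] show ?thesis
    unfolding split .
qed

text \<open>Gaussian elimination by columns: the induction is on the set of rows that differ from those of the identity
  matrix. If the diagonal entry of row \<open>j\<close> is nonzero, a matrix that agrees with the identity except in
  row \<open>j\<close> can be split off on the right; otherwise a shear first moves a nonzero entry of that row to the
  diagonal.\<close>

lemma right_mult_law_rows:
  fixes A :: "complex ^ 'r ^ 'r"
  assumes "finite J" "det A \<noteq> 0" "\<And>i. i \<notin> J \<Longrightarrow> A $ i = axis i 1"
  shows "right_mult_law TYPE('m::finite) A"
  using assms
proof (induction J arbitrary: A rule: finite_induct)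
  case empty
  then have "A = (\<chi> i k. if i = k then 1 else 0)"
    by (auto simp: vec_eq_iff axis_def)
  then show ?case
    using right_mult_law_diagonal[of "\<lambda>_. 1"] by auto
next
  case (insert j J)
  have pivot: "right_mult_law TYPE('m) B"
    if B: "det B \<noteq> 0" "\<And>i. i \<notin> insert j J \<Longrightarrow> B $ i = axis i 1" "B $ j $ j \<noteq> 0" for B
  proof -
    let ?E = "replace_row j (B $ j)"
    have lawE: "right_mult_law TYPE('m) ?E"
      using B by (intro right_mult_law_replace_row)
    then have E: "det ?E \<noteq> 0"
      by (simp add: right_mult_law_def)
    have "(B ** matrix_inv ?E) $ i = axis i 1" if "i \<notin> J" for i
    proof -
      have "B $ i = ?E $ i"
        using B(2) that by (auto simp: replace_row_def)
      then have "(B ** matrix_inv ?E) $ i = (?E ** matrix_inv ?E) $ i"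
        by (simp add: matrix_mult_row)
      then show ?thesis
        using E by (simp add: matrix_inv_mult mat_1_row)
    qed
    moreover have "det (B ** matrix_inv ?E) \<noteq> 0"
      using B E by (simp add: det_mul det_matrix_inv)
    ultimately have "right_mult_law TYPE('m) (B ** matrix_inv ?E)"
      by (intro insert.IH)
    from right_mult_law_mult[OF this lawE] show ?thesis
      using E by (simp add: matrix_inv_mult flip: matrix_mul_assoc)
  qed
  show ?case
  proof (cases "A $ j $ j = 0")
    case False
    with insert.prems show ?thesis
      by (intro pivot) auto
  next
    case True
    obtain k where k: "k \<in> J" "A $ j $ k \<noteq> 0"
    proof (rule ccontr)
      assume "\<not> thesis"
      with that True have zero: "A $ j $ l = 0" if "l \<in> insert j J" for l
        using that by blast
      \<comment> \<open>Row \<open>j\<close> would depend linearly on the unit rows outside \<open>J\<close>, with these coefficients.\<close>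
      define y :: "complex ^ 'r" where "y = (\<chi> i. if i = j then 1 else if i \<in> J then 0 else - A $ j $ i)"
      have "(transpose A *v y) $ l = 0" for l
      proof -
        have "(transpose A *v y) $ l = (\<Sum>i\<in>UNIV. (if i = j then A $ j $ l else 0) - (if i = l then (if l \<in> insert j J then 0 else A $ j $ l) else 0))"
        proof -
          have "A $ i $ l * y $ i = (if i = j then A $ j $ l else 0) - (if i = l then (if l \<in> insert j J then 0 else A $ j $ l) else 0)" for i
            by (cases "i \<in> insert j J") (auto simp: y_def axis_def insert.prems(2))
          then show ?thesis
            by (simp add: matrix_vector_mult_def transpose_def)
        qed
        also have "\<dots> = 0"
          using zero by (simp add: sum_subtractf)
        finally show ?thesis .
      qed
      then have "transpose A *v y = 0"
        by (simp add: vec_eq_iff)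
      moreover have "y $ j = 1"
        by (simp add: y_def)
      then have "y \<noteq> 0"
        by auto
      ultimately have "det (transpose A) = 0"
        unfolding det_eq_0_iff_kernel by blast
      then show False
        using insert.prems(1) by simp
    qed
    with insert.hyps have kj: "k \<noteq> j"
      by auto
    define F where "F s = replace_row k (axis k 1 + s *s axis j 1)" for s
    have lawF: "right_mult_law TYPE('m) (F s)" and detF: "det (F s) = 1" for s
      using right_mult_law_shear[of "axis k 1 + s *s axis j 1" k] kj by (simp_all add: F_def axis_def)
    have FF: "F 1 ** F (- 1) = mat 1"
    proof -
      have "F 1 ** F (- 1) = replace_row k (axis k 1)"
        unfolding F_def using kj by (subst replace_row_shear_mult) (simp_all add: axis_def vec_eq_iff)
      also have "\<dots> = mat 1"
        by (auto simp: replace_row_def vec_eq_iff mat_1_row)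
      finally show ?thesis .
    qed
    have row: "(A ** F 1) $ i = A $ i + A $ i $ k *s axis j 1" for i
      by (simp add: F_def replace_row_mult_row)
    have "right_mult_law TYPE('m) (A ** F 1)"
    proof (rule pivot)
      show "det (A ** F 1) \<noteq> 0"
        using insert.prems(1) by (simp add: det_mul detF)
      show "(A ** F 1) $ i = axis i 1" if "i \<notin> insert j J" for i
        using that k insert.prems(2)[OF that] by (auto simp: row axis_def vec_eq_iff)
      show "(A ** F 1) $ j $ j \<noteq> 0"
        using True k by (simp add: row)
    qed
    from right_mult_law_mult[OF this lawF[of "-1"]] show ?thesis
      by (simp add: FF flip: matrix_mul_assoc)
  qed
qed

text \<open>The exponent counts a complex Jacobian \<open>det A\<close> for each row, which acts on real volume through its
  squared modulus.\<close>

theorem nn_integral_lborel_mult_right: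
  fixes f :: "complex ^ 'r ^ 'm \<Rightarrow> ennreal"
  assumes "f \<in> borel_measurable borel" "det A \<noteq> 0"
  shows "(\<integral>\<^sup>+Z. f (Z ** A) \<partial>lborel) = ennreal (1 / norm (det A) ^ (2 * CARD('m))) * (\<integral>\<^sup>+Z. f Z \<partial>lborel)"
  using right_mult_law_rows[of UNIV A, where ?'m='m] assms by (simp add: right_mult_law_def)

corollary nn_integral_lborel_mult_left:
  fixes f :: "complex ^ 'r ^ 'r \<Rightarrow> ennreal"
  assumes [measurable]: "f \<in> borel_measurable borel" and A: "det A \<noteq> 0"
  shows "(\<integral>\<^sup>+Z. f (A ** Z) \<partial>lborel) = ennreal (1 / norm (det A) ^ (2 * CARD('r))) * (\<integral>\<^sup>+Z. f Z \<partial>lborel)"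
proof -
  let ?t = "transpose :: complex ^ 'r ^ 'r \<Rightarrow> _"
  have lin: "linear ?t"
    by (rule linearI) (simp_all add: vec_eq_iff transpose_def)
  have iso: "norm (?t Z) = norm Z" for Z
  proof -
    have "?t Z \<bullet> ?t Z = Z \<bullet> Z"
      unfolding inner_vec_def transpose_def by (subst sum.swap) simp
    then show ?thesis
      by (simp add: norm_eq_sqrt_inner)
  qed
  have t: "(\<integral>\<^sup>+Z. g (?t Z) \<partial>lborel) = (\<integral>\<^sup>+Z. g Z \<partial>lborel)"
    if "g \<in> borel_measurable borel" for g :: "complex ^ 'r ^ 'r \<Rightarrow> ennreal"
    by (rule nn_integral_lborel_isometry[OF that lin _ iso, where T'="?t"]) simp
  note [measurable] = borel_measurable_linear[OF lin]
  have "(\<integral>\<^sup>+Z. f (A ** Z) \<partial>lborel) = (\<integral>\<^sup>+Z. f (A ** ?t Z) \<partial>lborel)"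
    by (rule t[symmetric]) simp
  also have "\<dots> = (\<integral>\<^sup>+Z. f (?t (Z ** ?t A)) \<partial>lborel)"
    by (simp add: matrix_transpose_mul)
  also have "\<dots> = ennreal (1 / norm (det A) ^ (2 * CARD('r))) * (\<integral>\<^sup>+Z. f (?t Z) \<partial>lborel)"
    by (subst nn_integral_lborel_mult_right[of "\<lambda>Z. f (?t Z)"]) (simp_all add: A)
  finally show ?thesis
    by (simp add: t)
qed

section \<open>Rank deficient matrices form a null set\<close>

text \<open>The determinant of a matrix with linear polynomial entries is a polynomial.\<close>

lemma finite_roots_det_pencil:
  fixes A B :: "complex ^ 'n ^ 'n"
  assumes "det (\<chi> i j. A $ i $ j + t0 * B $ i $ j) \<noteq> 0"
  shows "finite {t. det (\<chi> i j. A $ i $ j + t * B $ i $ j) = 0}"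
proof -
  define p where "p = det (\<chi> i j. [:A $ i $ j, B $ i $ j:])"
  have poly: "poly p t = det (\<chi> i j. A $ i $ j + t * B $ i $ j)" for t
    by (simp add: p_def det_def poly_sum poly_prod of_int_poly)
  then have "p \<noteq> 0"
    using assms by (metis poly_0)
  then have "finite {t. poly p t = 0}"
    by (rule poly_roots_finite)
  then show ?thesis
    by (simp add: poly)
qed

lemma stiefel_nonempty:
  assumes "CARD('r) \<le> CARD('m)"
  shows "(stiefel :: (complex ^ 'r::finite ^ 'm::finite) set) \<noteq> {}"
proof -
  obtain \<sigma> :: "'r \<Rightarrow> 'm" where \<sigma>: "inj \<sigma>"
    using card_le_inj[OF finite_class.finite_UNIV finite_class.finite_UNIV assms] by auto
  define X :: "complex ^ 'r ^ 'm" where "X = (\<chi> i j. if i = \<sigma> j then 1 else 0)"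
  have "(conj_transpose X ** X) $ j $ k = mat 1 $ j $ k" for j k
  proof -
    have "(conj_transpose X ** X) $ j $ k = (\<Sum>i\<in>UNIV. if i = \<sigma> j then (if \<sigma> j = \<sigma> k then 1 else 0) else 0)"
      unfolding matrix_matrix_mult_def vec_lambda_beta by (rule sum.cong[OF refl]) (simp add: X_def)
    then show ?thesis
      using \<sigma> by (simp add: mat_def inj_eq)
  qed
  then have "X \<in> stiefel"
    by (simp add: stiefel_def vec_eq_iff)
  then show ?thesis
    by blast
qed

lemma closed_singular_gram: "closed {Z :: complex ^ 'r ^ 'm. det (conj_transpose Z ** Z) = 0}"
  by (intro closed_Collect_eq continuous_intros)

text \<open>If \<open>Z + t X\<close> has a kernel, then so has \<open>X\<^sup>* Z + t I\<close>, that is, \<open>-t\<close> is an eigenvalue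
  of \<open>X\<^sup>* Z\<close>.\<close>

lemma finite_rank_deficient_translates:
  fixes Z X :: "complex ^ 'r ^ 'm"
  assumes X: "X \<in> stiefel"
  shows "finite {t :: real. det (conj_transpose (Z + t *\<^sub>R X) ** (Z + t *\<^sub>R X)) = 0}"
proof -
  let ?M = "conj_transpose X ** Z"
  let ?pencil = "\<lambda>t. (\<chi> i j. ?M $ i $ j + t * mat 1 $ i $ j) :: complex ^ 'r ^ 'r"
  have pencil: "?pencil (of_real t) = conj_transpose X ** (Z + t *\<^sub>R X)" for t :: real
  proof -
    have "conj_transpose X ** (Z + t *\<^sub>R X) = ?M + t *\<^sub>R mat 1"
      using X by (simp add: matrix_mult_add_right matrix_mult_scaleR_right stiefel_def)
    then show ?thesis
      by (simp add: vec_eq_iff scaleR_conv_of_real[where 'a=complex])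
  qed
  have deficient: "det (?pencil (of_real t)) = 0" if zero: "det (conj_transpose (Z + t *\<^sub>R X) ** (Z + t *\<^sub>R X)) = 0" for t :: real
  proof -
    obtain x where "x \<noteq> 0" and x: "(conj_transpose (Z + t *\<^sub>R X) ** (Z + t *\<^sub>R X)) *v x = 0"
      using zero unfolding det_eq_0_iff_kernel by blast
    from x have "(Z + t *\<^sub>R X) *v x = 0"
      by (rule gram_kernel)
    then have "(conj_transpose X ** (Z + t *\<^sub>R X)) *v x = 0"
      by (simp flip: matrix_vector_mul_assoc)
    with \<open>x \<noteq> 0\<close> show ?thesis
      unfolding pencil det_eq_0_iff_kernel by blast
  qed
  \<comment> \<open>The eigenvalues of \<open>?M\<close> are bounded by its operator norm.\<close>
  have "det (?pencil (of_real (onorm ((*v) ?M) + 1))) \<noteq> 0"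
  proof
    assume "det (?pencil (of_real (onorm ((*v) ?M) + 1))) = 0"
    then obtain x where x: "x \<noteq> 0" "?pencil (of_real (onorm ((*v) ?M) + 1)) *v x = 0"
      unfolding det_eq_0_iff_kernel by blast
    have "?pencil (of_real t) *v x = ?M *v x + t *\<^sub>R x" for t :: real
    proof -
      have "?pencil (of_real t) = ?M + t *\<^sub>R mat 1"
        by (simp add: vec_eq_iff scaleR_conv_of_real[where 'a=complex])
      moreover have "(t *\<^sub>R mat 1) *v x = t *\<^sub>R x"
        by (simp add: vec_eq_iff matrix_vector_mult_def mat_def if_distrib[where f="\<lambda>x. x * _"] if_distrib[where f="(*\<^sub>R) _"] cong: if_cong)
      ultimately show ?thesis
        by (simp add: matrix_vector_mult_add_rdistrib)
    qed
    then have eq: "?M *v x = - (onorm ((*v) ?M) + 1) *\<^sub>R x"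
      using x(2) by (simp only: eq_neg_iff_add_eq_0 scaleR_minus_left)
    have nonneg: "0 \<le> onorm ((*v) ?M)"
      by (intro onorm_pos_le matrix_vector_mul_bounded_linear)
    have "(onorm ((*v) ?M) + 1) * norm x = norm (?M *v x)"
      unfolding eq norm_scaleR using nonneg by simp
    also have "\<dots> \<le> onorm ((*v) ?M) * norm x"
      by (rule onorm[OF matrix_vector_mul_bounded_linear])
    finally show False
      using x(1) by (simp add: algebra_simps)
  qed
  then have "finite {t. det (?pencil t) = 0}"
    by (rule finite_roots_det_pencil)
  then have "finite (of_real -` {t. det (?pencil t) = 0} :: real set)"
    by (rule finite_vimageI) (simp add: inj_def)
  then show ?thesis
    by (rule finite_subset[rotated]) (use deficient in auto)
qed

text \<open>Every line in the direction of a fixed point of the manifold meets the rank deficient matrices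
  in a finite set; Fubini and translation invariance do the rest.\<close>

lemma AE_full_rank:
  assumes "CARD('r) \<le> CARD('m)"
  shows "AE Z :: complex ^ 'r ^ 'm in lborel. rank Z = CARD('r)"
proof -
  obtain X :: "complex ^ 'r ^ 'm" where X: "X \<in> stiefel"
    using stiefel_nonempty[OF assms] by blast
  define N where "N = {Z :: complex ^ 'r ^ 'm. det (conj_transpose Z ** Z) = 0}"
  have [measurable]: "N \<in> sets borel"
    using closed_singular_gram unfolding N_def by (rule borel_closed)
  have "emeasure lborel N = (\<integral>\<^sup>+t. emeasure lborel N * indicator {0..1} (t::real) \<partial>lborel)"
    by (simp add: nn_integral_cmult)
  also have "\<dots> = (\<integral>\<^sup>+t. \<integral>\<^sup>+Z. indicator N (Z + t *\<^sub>R X) * indicator {0..1} (t::real) \<partial>lborel \<partial>lborel)"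
  proof (rule nn_integral_cong)
    fix t :: real
    have "emeasure lborel N = (\<integral>\<^sup>+Z. indicator N (t *\<^sub>R X + Z) \<partial>lborel)"
      by (subst nn_integral_lborel_translate) simp_all
    then show "emeasure lborel N * indicator {0..1} t = (\<integral>\<^sup>+Z. indicator N (Z + t *\<^sub>R X) * indicator {0..1} t \<partial>lborel)"
      by (simp add: nn_integral_multc add.commute)
  qed
  also have "\<dots> = (\<integral>\<^sup>+Z. \<integral>\<^sup>+t. indicator N (Z + t *\<^sub>R X) * indicator {0..1} (t::real) \<partial>lborel \<partial>lborel)"
    by (rule lborel_pair.Fubini') simp
  also have "\<dots> = (\<integral>\<^sup>+Z. 0 \<partial>(lborel :: (complex ^ 'r ^ 'm) measure))"
  proof (rule nn_integral_cong)
    fix Z :: "complex ^ 'r ^ 'm"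
    let ?S = "{t :: real. Z + t *\<^sub>R X \<in> N}"
    have fin: "finite ?S"
      unfolding N_def using finite_rank_deficient_translates[OF X, of Z] by simp
    have "(\<integral>\<^sup>+t. indicator N (Z + t *\<^sub>R X) * indicator {0..1} (t::real) \<partial>lborel) \<le> (\<integral>\<^sup>+t. indicator ?S t \<partial>lborel)"
      by (intro nn_integral_mono) (auto split: split_indicator)
    also have "\<dots> = emeasure lborel ?S"
      using fin by (intro nn_integral_indicator) (simp add: borel_closed finite_imp_closed)
    also have "\<dots> = 0"
      using fin by (rule emeasure_lborel_countable[OF countable_finite])
    finally show "(\<integral>\<^sup>+t. indicator N (Z + t *\<^sub>R X) * indicator {0..1} (t::real) \<partial>lborel) = 0"
      by simp
  qed
  finally have "N \<in> null_sets lborel"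
    by (simp add: null_sets_def)
  then show ?thesis
    by (rule AE_I') (auto simp: N_def rank_eq_card_iff_det_gram)
qed

lemma AE_nonsingular: "AE A :: complex ^ 'r ^ 'r in lborel. det A \<noteq> 0"
  using AE_full_rank[where ?'r='r and ?'m='r] by (simp add: rank_eq_card_iff_det)

section \<open>The orientation and the polar decomposition\<close>

lemma matrix_inv_nth:
  fixes A :: "complex ^ 'n ^ 'n"
  assumes "det A \<noteq> 0"
  shows "matrix_inv A $ i $ j = det (\<chi> k l. if l = i then axis j 1 $ k else A $ k $ l) / det A"
proof -
  have "A *v column j (matrix_inv A) = axis j 1"
    using matrix_inv_mult(1)[OF assms]
    by (simp add: column_matrix_mult[symmetric]) (simp add: column_def mat_def axis_def vec_eq_iff)
  then have "column j (matrix_inv A) = (\<chi> i. det (\<chi> k l. if l = i then axis j 1 $ k else A $ k $ l) / det A)"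
    by (subst (asm) cramer[OF assms])
  then show ?thesis
    by (simp add: column_def vec_eq_iff)
qed

text \<open>By Cramer's rule. This makes the orientation continuous on the matrices of full rank.\<close>

lemma continuous_on_matrix_inv [continuous_intros]:
  fixes f :: "'a::topological_space \<Rightarrow> complex ^ 'n ^ 'n"
  assumes f: "continuous_on S f" and nz: "\<And>x. x \<in> S \<Longrightarrow> det (f x) \<noteq> 0"
  shows "continuous_on S (\<lambda>x. matrix_inv (f x))"
proof -
  have "continuous_on S (\<lambda>x. \<chi> i j. det (\<chi> k l. if l = i then axis j 1 $ k else f x $ k $ l) / det (f x))"
  proof (intro continuous_on_vec_lambda continuous_intros f nz)
    show "continuous_on S (\<lambda>x. if l = i then axis j 1 $ k else f x $ k $ l)" for i j k l
      by (cases "l = i") (auto intro!: continuous_intros f)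
  qed (use nz in blast)
  then show ?thesis
    by (rule continuous_on_cong[THEN iffD1, rotated 2]) (simp_all add: vec_eq_iff matrix_inv_nth nz)
qed

lemma open_full_rank: "open {Z :: complex ^ 'r ^ 'm. rank Z = CARD('r)}"
  using closed_singular_gram by (simp add: rank_eq_card_iff_det_gram closed_def Collect_neg_eq)

lemma gram_pos_def: "hermitian_pos_def (conj_transpose Z ** Z)"
  if "rank Z = CARD('r)" for Z :: "complex ^ 'r ^ 'm"
  using gram_hermitian_pos_def[OF that hermitian_pos_def_mat_1] by simp

lemma orientation_borel_measurable [measurable]:
  "orientation \<in> borel_measurable (borel :: (complex ^ 'r ^ 'm) measure)"
proof -
  let ?F = "{Z :: complex ^ 'r ^ 'm. rank Z = CARD('r)}"
  have "continuous_on ?F (\<lambda>Z. hermitian_sqrt (conj_transpose Z ** Z))"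
    by (rule continuous_on_compose2[OF continuous_on_hermitian_sqrt]) (auto intro!: continuous_intros gram_pos_def)
  then have "continuous_on ?F (\<lambda>Z. Z ** matrix_inv (hermitian_sqrt (conj_transpose Z ** Z)))"
    by (intro continuous_intros) (auto intro!: det_hermitian_sqrt_nz gram_pos_def)
  then have "(\<lambda>Z. if Z \<in> ?F then Z ** matrix_inv (hermitian_sqrt (conj_transpose Z ** Z)) else (SOME X. X \<in> stiefel)) \<in> borel_measurable borel"
    using open_full_rank by (intro borel_measurable_continuous_on_if) (auto intro: borel_open)
  then show ?thesis
    by (simp add: orientation_def[abs_def])
qed

text \<open>Uniqueness of the polar decomposition. All transformation rules of the orientation follow by exhibiting
  a factorization of this form.\<close>

lemma orientation_eqI:
  fixes X :: "complex ^ 'r ^ 'm"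
  assumes X: "X \<in> stiefel" and S: "hermitian_pos_def S" and Z: "Z = X ** S"
  shows "orientation Z = X" "rank Z = CARD('r)"
proof -
  have "conj_transpose Z ** Z = conj_transpose S ** (conj_transpose X ** X) ** S"
    by (simp add: Z conj_transpose_mult matrix_mul_assoc)
  then have gram: "conj_transpose Z ** Z = S ** S"
    using X S by (simp add: stiefel_def hermitian_pos_def_iff)
  have nz: "det S \<noteq> 0"
    using S by (rule hermitian_pos_def_det_nz)
  then show rank: "rank Z = CARD('r)"
    by (simp add: rank_eq_card_iff_det_gram gram det_mul)
  have "hermitian_sqrt (conj_transpose Z ** Z) = S"
    using S gram by (intro hermitian_sqrt_eqI) simp_all
  then show "orientation Z = X"
    using rank nz by (simp add: orientation_def Z matrix_inv_mult flip: matrix_mul_assoc)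
qed

lemma polar_decomposition:
  fixes Z :: "complex ^ 'r ^ 'm"
  assumes rank: "rank Z = CARD('r)"
  defines "S \<equiv> hermitian_sqrt (conj_transpose Z ** Z)"
  shows "hermitian_pos_def S" "S ** S = conj_transpose Z ** Z" "orientation Z \<in> stiefel" "Z = orientation Z ** S"
proof -
  note gram = gram_pos_def[OF rank]
  show S: "hermitian_pos_def S" "S ** S = conj_transpose Z ** Z"
    unfolding S_def by (rule hermitian_sqrt gram)+
  note inv = matrix_inv_mult[OF hermitian_pos_def_det_nz[OF S(1)]]
  have H: "orientation Z = Z ** matrix_inv S"
    by (simp add: orientation_def rank S_def)
  then show "Z = orientation Z ** S"
    by (simp add: inv flip: matrix_mul_assoc)
  have herm: "conj_transpose (matrix_inv S) = matrix_inv S"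
    using hermitian_pos_def_matrix_inv[OF S(1)] by (simp add: hermitian_pos_def_iff)
  have "conj_transpose (orientation Z) ** orientation Z = matrix_inv S ** (S ** S) ** matrix_inv S"
    by (simp add: H conj_transpose_mult herm S(2) matrix_mul_assoc)
  also have "\<dots> = (matrix_inv S ** S) ** (S ** matrix_inv S)"
    by (simp add: matrix_mul_assoc)
  finally show "orientation Z \<in> stiefel"
    by (simp add: inv stiefel_def)
qed

lemma orientation_in_stiefel:
  assumes "CARD('r) \<le> CARD('m)"
  shows "orientation (Z :: complex ^ 'r ^ 'm) \<in> stiefel"
proof (cases "rank Z = CARD('r)")
  case True
  then show ?thesis
    by (rule polar_decomposition)
next
  case False
  then show ?thesis
    using some_in_eq[of stiefel] stiefel_nonempty[OF assms] by (auto simp: orientation_def)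
qed

lemma orientation_unitary:
  fixes Z :: "complex ^ 'r ^ 'm" and U :: "complex ^ 'm ^ 'm" and Q :: "complex ^ 'r ^ 'r"
  assumes rank: "rank Z = CARD('r)" and U: "conj_transpose U ** U = mat 1" and Q: "conj_transpose Q ** Q = mat 1"
  shows "orientation (U ** Z ** Q) = U ** orientation Z ** Q" "rank (U ** Z ** Q) = CARD('r)"
proof -
  let ?H = "orientation Z" and ?S = "hermitian_sqrt (conj_transpose Z ** Z)"
  note pd = polar_decomposition[OF rank]
  have Q': "Q ** conj_transpose Q = mat 1"
    using Q by (rule matrix_left_right_inverse1)
  have "conj_transpose (U ** ?H ** Q) ** (U ** ?H ** Q)
      = conj_transpose Q ** (conj_transpose ?H ** (conj_transpose U ** U) ** ?H) ** Q"
    by (simp only: conj_transpose_mult matrix_mul_assoc)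
  then have 1: "U ** ?H ** Q \<in> stiefel"
    using pd(3) U Q by (simp add: stiefel_def)
  have "det Q \<noteq> 0"
    using Q by (metis det_I det_mul mult_zero_right zero_neq_one)
  then have 2: "hermitian_pos_def (conj_transpose Q ** ?S ** Q)"
    using pd(1) by (intro gram_hermitian_pos_def) (simp_all add: rank_eq_card_iff_det)
  have "U ** ?H ** Q ** (conj_transpose Q ** ?S ** Q) = U ** (?H ** (Q ** conj_transpose Q) ** ?S) ** Q"
    by (simp only: matrix_mul_assoc)
  also have "\<dots> = U ** Z ** Q"
    by (simp add: Q' flip: pd(4))
  finally have 3: "U ** Z ** Q = U ** ?H ** Q ** (conj_transpose Q ** ?S ** Q)" ..
  show "orientation (U ** Z ** Q) = U ** ?H ** Q" "rank (U ** Z ** Q) = CARD('r)"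
    by (rule orientation_eqI[OF 1 2 3])+
qed

text \<open>Polar decomposition of \<open>S A\<close>, where \<open>S\<close> is the positive definite factor of \<open>Z\<close>: the column
  space does not change, so the orientation changes by a unitary factor only.\<close>

lemma orientation_mult_right:
  fixes Z :: "complex ^ 'r ^ 'm" and A :: "complex ^ 'r ^ 'r"
  assumes rank: "rank Z = CARD('r)" and A: "det A \<noteq> 0"
  obtains V where "conj_transpose V ** V = mat 1" "orientation (Z ** A) = orientation Z ** V"
proof
  let ?H = "orientation Z" and ?S = "hermitian_sqrt (conj_transpose Z ** Z)"
  note pd = polar_decomposition[OF rank]
  have "rank (?S ** A) = CARD('r)"
    using A hermitian_pos_def_det_nz[OF pd(1)] by (simp add: rank_eq_card_iff_det det_mul)
  note pd' = polar_decomposition[OF this]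
  let ?V = "orientation (?S ** A)"
  show V: "conj_transpose ?V ** ?V = mat 1"
    using pd'(3) by (simp add: stiefel_def)
  have "conj_transpose (?H ** ?V) ** (?H ** ?V) = conj_transpose ?V ** (conj_transpose ?H ** ?H) ** ?V"
    by (simp only: conj_transpose_mult matrix_mul_assoc)
  then have 1: "?H ** ?V \<in> stiefel"
    using pd(3) V by (simp add: stiefel_def)
  have "Z ** A = ?H ** (?S ** A)"
    by (metis pd(4) matrix_mul_assoc)
  also have "\<dots> = ?H ** ?V ** hermitian_sqrt (conj_transpose (?S ** A) ** (?S ** A))"
    by (metis pd'(4) matrix_mul_assoc)
  finally show "orientation (Z ** A) = ?H ** ?V"
    by (rule orientation_eqI(1)[OF 1 pd'(1)])
qed

lemma det_orientation_gram:
  fixes Z :: "complex ^ 'r ^ 'm"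
  assumes rank: "rank Z = CARD('r)" and Q: "hermitian_pos_def Q"
  shows "Re (det (conj_transpose (orientation Z) ** Q ** orientation Z))
    = Re (det (conj_transpose Z ** Q ** Z)) / Re (det (conj_transpose Z ** Z))"
proof -
  let ?H = "orientation Z" and ?S = "hermitian_sqrt (conj_transpose Z ** Z)"
  note pd = polar_decomposition[OF rank]
  have rankH: "rank ?H = CARD('r)"
    using pd(3) by (simp add: rank_eq_card_iff_det_gram stiefel_def)
  have "conj_transpose Z ** Q ** Z = conj_transpose (?H ** ?S) ** Q ** (?H ** ?S)"
    by (simp flip: pd(4))
  also have "\<dots> = ?S ** (conj_transpose ?H ** Q ** ?H) ** ?S"
    using pd(1) by (simp add: conj_transpose_mult matrix_mul_assoc hermitian_pos_def_iff)
  finally have "det (conj_transpose Z ** Q ** Z) = det (?S ** ?S) * det (conj_transpose ?H ** Q ** ?H)"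
    by (simp add: det_mul)
  also have "?S ** ?S = conj_transpose Z ** Z"
    by (rule pd(2))
  finally have eq: "det (conj_transpose Z ** Q ** Z) = det (conj_transpose Z ** Z) * det (conj_transpose ?H ** Q ** ?H)" .
  note gram = det_hermitian_pos_def[OF gram_pos_def[OF rank]]
  have "Re (det (conj_transpose Z ** Q ** Z)) = Re (det (conj_transpose Z ** Z)) * Re (det (conj_transpose ?H ** Q ** ?H))"
    unfolding eq by (subst gram(1)) simp
  then show ?thesis
    using gram(2) by simp
qed

lemma norm_mult_left_unitary: "norm (U ** Z) = norm Z" if "conj_transpose U ** U = mat 1"
  for Z :: "complex ^ 'r ^ 'm"
  by (simp add: norm_eq_sqrt_inner inner_mult_left_adjoint matrix_mul_assoc that)

lemma norm_mult_right_unitary: "norm (Z ** Q) = norm Z" if "conj_transpose Q ** Q = mat 1"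
  for Z :: "complex ^ 'r ^ 'm" and Q :: "complex ^ 'r ^ 'r"
proof -
  have "Q ** conj_transpose Q = mat 1"
    using that by (rule matrix_left_right_inverse1)
  then show ?thesis
    by (simp add: norm_eq_sqrt_inner inner_mult_right_adjoint flip: matrix_mul_assoc)
qed

text \<open>The norm depends on the Gram matrix only. It allows an \<open>m \<times> r\<close> matrix to be replaced by
  the \<open>r \<times> r\<close> square root of its Gram matrix, to which square substitutions apply.\<close>

lemma norm_mult_cong_gram:
  fixes X :: "complex ^ 'r ^ 'm" and Y :: "complex ^ 'r ^ 'k" and A :: "complex ^ 'n ^ 'r"
  assumes "conj_transpose X ** X = conj_transpose Y ** Y"
  shows "norm (X ** A) = norm (Y ** A)"
proof -
  have "(norm (X ** A))\<^sup>2 = Re (trace (conj_transpose A ** (conj_transpose X ** X) ** A))"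
    by (simp add: norm_matrix_conv_trace conj_transpose_mult matrix_mul_assoc)
  also have "\<dots> = (norm (Y ** A))\<^sup>2"
    by (simp add: assms) (simp add: norm_matrix_conv_trace conj_transpose_mult matrix_mul_assoc)
  finally show ?thesis
    by simp
qed

section \<open>Gaussian matrices\<close>

definition gaussian_density :: "'a::euclidean_space \<Rightarrow> real" where
  "gaussian_density x = exp (- (norm x)\<^sup>2) / sqrt pi ^ DIM('a)"

lemma gaussian_density_measurable [measurable]: "gaussian_density \<in> borel_measurable borel"
  unfolding gaussian_density_def by measurable

lemma nn_integral_gaussian_density: "(\<integral>\<^sup>+x. ennreal (gaussian_density (x::'a::euclidean_space)) \<partial>lborel) = 1"
proof -
  have "(\<integral>\<^sup>+x. ennreal (gaussian_density (x::'a)) \<partial>lborel) = (\<integral>\<^sup>+x. ennreal (exp (- (norm (x::'a))\<^sup>2)) / ennreal (sqrt pi ^ DIM('a)) \<partial>lborel)"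
    by (simp add: gaussian_density_def divide_ennreal)
  also have "\<dots> = (\<integral>\<^sup>+x. ennreal (exp (- (norm (x::'a))\<^sup>2)) \<partial>lborel) / ennreal (sqrt pi ^ DIM('a))"
    by (rule nn_integral_divide) simp
  also have "\<dots> = 1"
    by (simp add: nn_integral_gaussian divide_ennreal)
  finally show ?thesis .
qed

lemma nn_integral_unitary:
  fixes f :: "complex ^ 'r ^ 'm \<Rightarrow> ennreal" and U :: "complex ^ 'm ^ 'm" and Q :: "complex ^ 'r ^ 'r"
  assumes "f \<in> borel_measurable borel" and U: "conj_transpose U ** U = mat 1" and Q: "conj_transpose Q ** Q = mat 1"
  shows "(\<integral>\<^sup>+Z. f (U ** Z ** Q) \<partial>lborel) = (\<integral>\<^sup>+Z. f Z \<partial>lborel)"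
proof (rule nn_integral_lborel_isometry[OF assms(1), where T'="\<lambda>Z. conj_transpose U ** Z ** conj_transpose Q"])
  show "linear (\<lambda>Z. U ** Z ** Q)"
    using linear_compose[OF linear_matrix_mult_left linear_matrix_mult_right] by (simp add: comp_def)
  have "U ** conj_transpose U = mat 1"
    using U by (rule matrix_left_right_inverse1)
  then have "U ** (conj_transpose U ** Z ** conj_transpose Q) ** Q = Z ** (conj_transpose Q ** Q)" for Z
    by (simp add: matrix_mul_assoc)
  then show "U ** (conj_transpose U ** Z ** conj_transpose Q) ** Q = Z" for Z
    using Q by simp
  show "norm (U ** Z ** Q) = norm Z" for Z
    using U Q by (simp add: norm_mult_left_unitary norm_mult_right_unitary)
qed

lemma nn_integral_gaussian_unitary:
  fixes f :: "complex ^ 'r ^ 'm \<Rightarrow> ennreal" and U :: "complex ^ 'm ^ 'm" and Q :: "complex ^ 'r ^ 'r"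
  assumes [measurable]: "f \<in> borel_measurable borel" and U: "conj_transpose U ** U = mat 1" and Q: "conj_transpose Q ** Q = mat 1"
  shows "(\<integral>\<^sup>+Z. f (U ** Z ** Q) * ennreal (gaussian_density Z) \<partial>lborel) = (\<integral>\<^sup>+Z. f Z * ennreal (gaussian_density Z) \<partial>lborel)"
  using nn_integral_unitary[of "\<lambda>Z. f Z * ennreal (gaussian_density Z)" U Q] U Q
  by (simp add: gaussian_density_def norm_mult_left_unitary norm_mult_right_unitary)

section \<open>The invariant measure is the law of a Gaussian orientation\<close>

lemma stiefel_borel [measurable]: "stiefel \<in> sets borel"
  unfolding stiefel_def by (intro borel_closed closed_Collect_eq continuous_intros)

lemma sets_stiefel_iff:
  "B \<in> sets (restrict_space borel stiefel) \<longleftrightarrow> B \<subseteq> stiefel \<and> B \<in> sets borel" for B :: "(complex ^ 'r ^ 'm) set"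
  by (subst sets_restrict_space_iff) (auto simp: stiefel_borel)

text \<open>The model of the invariant probability measure in which all computations take place.\<close>

definition orientation_law :: "(complex ^ 'r ^ 'm) measure" where
  "orientation_law = distr (density lborel gaussian_density) (restrict_space borel stiefel) orientation"

lemma sets_orientation_law [simp]: "sets orientation_law = sets (restrict_space borel stiefel)"
  and space_orientation_law [simp]: "space orientation_law = stiefel"
  by (simp_all add: orientation_law_def space_restrict_space)

lemma orientation_measurable_stiefel:
  assumes "CARD('r) \<le> CARD('m)" "sets M = sets borel"
  shows "(orientation :: complex ^ 'r ^ 'm \<Rightarrow> _) \<in> measurable M (restrict_space borel stiefel)"
  using assms(1) by (auto intro!: measurable_restrict_space2 orientation_in_stiefel simp: measurable_cong_sets[OF assms(2) refl])

lemma nn_integral_orientation_law: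
  fixes f :: "complex ^ 'r ^ 'm \<Rightarrow> ennreal"
  assumes r: "CARD('r) \<le> CARD('m)" and [measurable]: "f \<in> borel_measurable borel"
  shows "(\<integral>\<^sup>+X. f X \<partial>orientation_law) = (\<integral>\<^sup>+Z. f (orientation Z) * ennreal (gaussian_density Z) \<partial>lborel)"
proof -
  have "(\<integral>\<^sup>+X. f X \<partial>orientation_law) = (\<integral>\<^sup>+Z. f (orientation Z) \<partial>density lborel gaussian_density)"
    unfolding orientation_law_def
    by (rule nn_integral_distr) (auto intro!: orientation_measurable_stiefel r measurable_restrict_space1)
  also have "\<dots> = (\<integral>\<^sup>+Z. f (orientation Z) * ennreal (gaussian_density Z) \<partial>lborel)"
    by (subst nn_integral_density) (simp_all add: mult.commute)
  finally show ?thesis .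
qed

lemma unitary_preserves_stiefel:
  assumes "conj_transpose U ** U = mat 1" "conj_transpose Q ** Q = mat 1" "X \<in> stiefel"
  shows "U ** X ** Q \<in> stiefel"
proof -
  have "conj_transpose (U ** X ** Q) ** (U ** X ** Q) = conj_transpose Q ** (conj_transpose X ** (conj_transpose U ** U) ** X) ** Q"
    by (simp only: conj_transpose_mult matrix_mul_assoc)
  then show ?thesis
    using assms by (simp add: stiefel_def)
qed

lemma measurable_unitary_action:
  fixes U :: "complex ^ 'm ^ 'm" and Q :: "complex ^ 'r ^ 'r"
  assumes "conj_transpose U ** U = mat 1" "conj_transpose Q ** Q = mat 1"
    and \<mu>: "sets \<mu> = sets (restrict_space borel stiefel)"
  shows "(\<lambda>X. U ** X ** Q) \<in> measurable \<mu> \<mu>"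
proof -
  have "(\<lambda>X. U ** X ** Q) \<in> borel_measurable (borel :: (complex ^ 'r ^ 'm) measure)"
    by measurable
  then have "(\<lambda>X. U ** X ** Q) \<in> measurable (restrict_space borel stiefel) (restrict_space borel (stiefel :: (complex ^ 'r ^ 'm) set))"
    using unitary_preserves_stiefel[OF assms(1,2)]
    by (intro measurable_restrict_space3) (auto simp: space_restrict_space)
  then show ?thesis
    by (subst measurable_cong_sets[OF \<mu> \<mu>])
qed

lemma invariant_orientation_law:
  assumes r: "CARD('r) \<le> CARD('m)"
  shows "invariant_stiefel_prob (orientation_law :: (complex ^ 'r ^ 'm) measure)"
  unfolding invariant_stiefel_prob_def
proof (intro conjI allI impI)
  let ?L = "orientation_law :: (complex ^ 'r ^ 'm) measure"
  have "emeasure ?L (space ?L) = (\<integral>\<^sup>+X. indicator stiefel X \<partial>?L)"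
    by (simp add: sets_stiefel_iff)
  also have "\<dots> = (\<integral>\<^sup>+Z. ennreal (gaussian_density Z) \<partial>(lborel :: (complex ^ 'r ^ 'm) measure))"
    by (subst nn_integral_orientation_law[OF r]) (simp_all add: orientation_in_stiefel[OF r])
  finally show "prob_space ?L"
    by (intro prob_spaceI) (simp add: nn_integral_gaussian_density)
  fix U :: "complex ^ 'm ^ 'm" and Q :: "complex ^ 'r ^ 'r"
  assume "unitary_matrix U" "unitary_matrix Q"
  then have U: "conj_transpose U ** U = mat 1" and Q: "conj_transpose Q ** Q = mat 1"
    by (auto simp: unitary_matrix_def)
  show "distr ?L ?L (\<lambda>X. U ** X ** Q) = ?L"
  proof (rule measure_eqI)
    fix B assume "B \<in> sets (distr ?L ?L (\<lambda>X. U ** X ** Q))"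
    then have B: "B \<in> sets ?L"
      by simp
    then have [measurable]: "B \<in> sets borel"
      by (simp add: sets_stiefel_iff)
    have "emeasure (distr ?L ?L (\<lambda>X. U ** X ** Q)) B = (\<integral>\<^sup>+X. indicator B X \<partial>distr ?L ?L (\<lambda>X. U ** X ** Q))"
      using B by simp
    also have "\<dots> = (\<integral>\<^sup>+X. indicator B (U ** X ** Q) \<partial>?L)"
      using B by (intro nn_integral_distr measurable_unitary_action[OF U Q] borel_measurable_indicator) simp_all
    also have "\<dots> = (\<integral>\<^sup>+Z. indicator B (U ** orientation Z ** Q) * ennreal (gaussian_density Z) \<partial>lborel)"
      by (rule nn_integral_orientation_law[OF r]) simp
    also have "\<dots> = (\<integral>\<^sup>+Z. indicator B (orientation (U ** Z ** Q)) * ennreal (gaussian_density Z) \<partial>lborel)"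
      using AE_full_rank[OF r] by (intro nn_integral_cong_AE) (auto simp: orientation_unitary(1)[OF _ U Q])
    also have "\<dots> = (\<integral>\<^sup>+Z. indicator B (orientation Z) * ennreal (gaussian_density Z) \<partial>lborel)"
      by (rule nn_integral_gaussian_unitary[OF _ U Q]) simp
    also have "\<dots> = (\<integral>\<^sup>+X. indicator B X \<partial>?L)"
      by (rule nn_integral_orientation_law[OF r, symmetric]) simp
    finally show "emeasure (distr ?L ?L (\<lambda>X. U ** X ** Q)) B = emeasure ?L B"
      using B by simp
  qed simp
qed simp_all

lemma mat_mult_commute: "mat c ** X = X ** mat c" for X :: "complex ^ 'r ^ 'm"
  by (simp add: vec_eq_iff matrix_matrix_mult_def mat_def mult.commute
      if_distrib[where f="\<lambda>x. x * _"] if_distrib[where f="(*) _"] cong: if_cong)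

text \<open>A block analogue of the Householder reflection that exchanges two unit vectors: with \<open>D = X - Y\<close>, the
  matrix \<open>V = I - D (D\<^sup>* X)\<^sup>-\<^sup>1 D\<^sup>*\<close> maps \<open>X\<close> to \<open>X - D = Y\<close>, and it is unitary because
  \<open>D\<^sup>* D = S + S\<^sup>*\<close> for \<open>S = D\<^sup>* X\<close>. The determinant condition is invertibility of \<open>S\<close>.\<close>

lemma unitary_transitive_generic:
  fixes X Y :: "complex ^ 'r ^ 'm"
  assumes X: "X \<in> stiefel" and Y: "Y \<in> stiefel" and nz: "det (mat 1 - conj_transpose Y ** X) \<noteq> 0"
  obtains V where "conj_transpose V ** V = mat 1" "Y = V ** X"
proof
  define D where "D = X - Y"
  define S where "S = conj_transpose D ** X"
  have XX: "conj_transpose X ** X = mat 1" and YY: "conj_transpose Y ** Y = mat 1"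
    using X Y by (auto simp: stiefel_def)
  have S: "S = mat 1 - conj_transpose Y ** X"
    by (simp add: S_def D_def conj_transpose_diff matrix_mult_diff_left XX)
  define T where "T = matrix_inv S"
  have ST: "S ** T = mat 1" "T ** S = mat 1"
    using nz matrix_inv_mult unfolding S T_def by blast+
  have ST': "conj_transpose T ** conj_transpose S = mat 1"
    by (simp add: ST flip: conj_transpose_mult)
  have DD: "conj_transpose D ** D = S + conj_transpose S"
    by (simp add: S D_def conj_transpose_diff conj_transpose_mult matrix_mult_diff_left matrix_mult_diff_right XX YY)
  define V where "V = mat 1 - D ** T ** conj_transpose D"
  have "V ** X = X - D ** (T ** S)"
    by (simp add: V_def matrix_mult_diff_left S_def matrix_mul_assoc)
  then show "Y = V ** X"
    by (simp add: ST D_def)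
  have V': "conj_transpose V = mat 1 - D ** conj_transpose T ** conj_transpose D"
    by (simp add: V_def conj_transpose_diff conj_transpose_mult matrix_mul_assoc)
  have TDDT: "conj_transpose T ** (conj_transpose D ** D) ** T = conj_transpose T + T"
  proof -
    have "conj_transpose T ** (S + conj_transpose S) ** T
        = conj_transpose T ** (S ** T) + (conj_transpose T ** conj_transpose S) ** T"
      by (simp add: matrix_mult_add_left matrix_mult_add_right matrix_mul_assoc)
    then show ?thesis
      by (simp add: DD ST ST')
  qed
  have "conj_transpose V ** V = mat 1 - D ** T ** conj_transpose D - D ** conj_transpose T ** conj_transpose D
      + D ** (conj_transpose T ** (conj_transpose D ** D) ** T) ** conj_transpose D"
    unfolding V' by (simp add: V_def matrix_mult_diff_left matrix_mult_diff_right matrix_mul_assoc)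
  also have "\<dots> = mat 1"
    unfolding TDDT by (simp add: matrix_mult_add_left matrix_mult_add_right)
  finally show "conj_transpose V ** V = mat 1" .
qed

text \<open>Replacing \<open>Y\<close> by a multiple \<open>z Y\<close> with \<open>z\<close> on the unit circle reaches the generic situation, since only
  finitely many \<open>z\<close> are exceptional; the scalar is undone afterwards.\<close>

lemma unitary_transitive:
  fixes X Y :: "complex ^ 'r ^ 'm"
  assumes X: "X \<in> stiefel" and Y: "Y \<in> stiefel"
  obtains V where "conj_transpose V ** V = mat 1" "Y = V ** X"
proof -
  have "finite {z. det (\<chi> i j. mat 1 $ i $ j + z * (- (conj_transpose Y ** X)) $ i $ j) = 0}"
    by (rule finite_roots_det_pencil[where ?t0.0=0]) simp
  moreover have "infinite (sphere (0::complex) 1)"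
  proof -
    have "1 \<in> sphere (0::complex) 1" "- 1 \<in> sphere (0::complex) 1"
      by simp_all
    moreover have "connected (sphere (0::complex) 1)"
      by (rule connected_sphere) simp
    ultimately show ?thesis
      using connected_finite_iff_sing by (metis empty_iff singletonD one_neq_neg_one)
  qed
  ultimately obtain z where z: "z \<in> sphere (0::complex) 1"
    and nz: "det (\<chi> i j. mat 1 $ i $ j + z * (- (conj_transpose Y ** X)) $ i $ j) \<noteq> 0"
    by (metis (mono_tags, lifting) finite_subset mem_Collect_eq subsetI)
  have zz: "cnj z * z = 1"
    using z by (metis complex_norm_square mem_sphere_0 mult.commute of_real_1 one_power2)
  have mat_mat: "mat a ** mat b = mat (a * b)" for a b :: complex
    by (simp add: vec_eq_iff matrix_matrix_mult_def mat_def if_distrib[where f="\<lambda>x. x * _"] cong: if_cong)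
  have ct_mat: "conj_transpose (mat a) = mat (cnj a)" for a
    by (auto simp: vec_eq_iff mat_def)
  let ?Y = "Y ** mat (cnj z)"
  have "conj_transpose ?Y ** ?Y = mat z ** (conj_transpose Y ** Y) ** mat (cnj z)"
    by (simp add: conj_transpose_mult ct_mat matrix_mul_assoc)
  then have Y': "?Y \<in> stiefel"
    using Y zz by (simp add: stiefel_def mat_mat mult.commute)
  have "mat 1 - conj_transpose ?Y ** X = mat 1 - mat z ** (conj_transpose Y ** X)"
    by (simp add: conj_transpose_mult ct_mat matrix_mul_assoc)
  also have "\<dots> = (\<chi> i j. mat 1 $ i $ j + z * (- (conj_transpose Y ** X)) $ i $ j)"
  proof -
    have "(mat z ** A) $ i $ j = z * A $ i $ j" for A :: "complex ^ 'r ^ 'r" and i j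
      by (simp add: matrix_matrix_mult_def mat_def if_distrib[where f="\<lambda>x. x * _"] cong: if_cong)
    then show ?thesis
      by (simp add: vec_eq_iff)
  qed
  finally have "det (mat 1 - conj_transpose ?Y ** X) \<noteq> 0"
    using nz by simp
  then obtain V where V: "conj_transpose V ** V = mat 1" "?Y = V ** X"
    using unitary_transitive_generic[OF X Y'] by blast
  show ?thesis
  proof (rule that)
    have "conj_transpose (mat z ** V) ** (mat z ** V) = conj_transpose V ** (mat (cnj z) ** mat z) ** V"
      by (simp add: conj_transpose_mult ct_mat matrix_mul_assoc)
    then show "conj_transpose (mat z ** V) ** (mat z ** V) = mat 1"
      using V(1) zz by (simp add: mat_mat)
    have "Y = Y ** (mat (cnj z) ** mat z)"
      by (simp add: mat_mat zz)
    also have "\<dots> = mat z ** ?Y"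
      by (subst mat_mult_commute[of z ?Y]) (rule matrix_mul_assoc)
    also have "\<dots> = mat z ** V ** X"
      by (simp add: V(2) matrix_mul_assoc)
    finally show "Y = mat z ** V ** X" .
  qed
qed

text \<open>Haar averaging. The orientation of a Gaussian square matrix \<open>W\<close> is a random unitary matrix, so
  invariance and Fubini give \<open>\<mu> B\<close> as the \<open>\<mu>\<close>-mean over \<open>X\<close> of the probability that
  the orientation of \<open>W\<close> moves \<open>X\<close> into \<open>B\<close>. This probability does not depend on \<open>X\<close>: writing
  \<open>X = V X\<^sub>0\<close>, the factor \<open>V\<close> can be absorbed into \<open>W\<close>. The right-hand side does not mention \<open>\<mu>\<close>, so
  there is at most one invariant probability measure.\<close>

lemma invariant_stiefel_prob_emeasure:
  fixes \<mu> :: "(complex ^ 'r ^ 'm) measure"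
  assumes \<mu>: "invariant_stiefel_prob \<mu>" and B: "B \<in> sets \<mu>" and X\<^sub>0: "X\<^sub>0 \<in> stiefel"
  shows "emeasure \<mu> B = (\<integral>\<^sup>+W. indicator B (orientation W ** X\<^sub>0) * ennreal (gaussian_density W) \<partial>(lborel :: (complex ^ 'm ^ 'm) measure))"
    (is "_ = ?c")
proof -
  interpret \<mu>: prob_space \<mu>
    using \<mu> by (simp add: invariant_stiefel_prob_def)
  interpret pair_sigma_finite lborel \<mu> ..
  have sets_\<mu>: "sets \<mu> = sets (restrict_space borel stiefel)" and space_\<mu>: "space \<mu> = stiefel"
    using \<mu> by (auto simp: invariant_stiefel_prob_def)
  have [measurable]: "(\<lambda>X. X) \<in> borel_measurable \<mu>"
    by (subst measurable_cong_sets[OF sets_\<mu> refl]) (rule measurable_restrict_space1, rule measurable_ident_sets[OF refl])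
  have [measurable]: "B \<in> sets borel"
    using B by (simp add: sets_\<mu> sets_stiefel_iff)
  have translate: "emeasure \<mu> B = (\<integral>\<^sup>+X. indicator B (U ** X) \<partial>\<mu>)" if U: "conj_transpose U ** U = mat 1" for U :: "complex ^ 'm ^ 'm"
  proof -
    have "distr \<mu> \<mu> (\<lambda>X. U ** X ** mat 1) = \<mu>"
      using \<mu> U matrix_left_right_inverse1[OF U]
      by (simp add: invariant_stiefel_prob_def unitary_matrix_def del: matrix_mul_rid)
    then have "emeasure \<mu> B = (\<integral>\<^sup>+X. indicator B X \<partial>distr \<mu> \<mu> (\<lambda>X. U ** X))"
      using B by simp
    also have "\<dots> = (\<integral>\<^sup>+X. indicator B (U ** X) \<partial>\<mu>)"
      using B measurable_unitary_action[OF U _ sets_\<mu>, of "mat 1"] by (intro nn_integral_distr) simp_all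
    finally show ?thesis .
  qed
  have "emeasure \<mu> B = (\<integral>\<^sup>+W. emeasure \<mu> B * ennreal (gaussian_density W) \<partial>(lborel :: (complex ^ 'm ^ 'm) measure))"
    by (simp add: nn_integral_cmult nn_integral_gaussian_density)
  also have "\<dots> = (\<integral>\<^sup>+W. \<integral>\<^sup>+X. indicator B (orientation W ** X) * ennreal (gaussian_density W) \<partial>\<mu> \<partial>(lborel :: (complex ^ 'm ^ 'm) measure))"
  proof (intro nn_integral_cong)
    fix W :: "complex ^ 'm ^ 'm"
    have "conj_transpose (orientation W) ** orientation W = mat 1"
      using orientation_in_stiefel[of W] by (simp add: stiefel_def)
    then show "emeasure \<mu> B * ennreal (gaussian_density W) = (\<integral>\<^sup>+X. indicator B (orientation W ** X) * ennreal (gaussian_density W) \<partial>\<mu>)"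
      by (subst translate) (simp_all add: nn_integral_multc)
  qed
  also have "\<dots> = (\<integral>\<^sup>+X. \<integral>\<^sup>+W. indicator B (orientation W ** X) * ennreal (gaussian_density W) \<partial>(lborel :: (complex ^ 'm ^ 'm) measure) \<partial>\<mu>)"
    by (rule Fubini'[symmetric]) measurable
  also have "\<dots> = (\<integral>\<^sup>+X. ?c \<partial>\<mu>)"
  proof (rule nn_integral_cong)
    fix X assume "X \<in> space \<mu>"
    then obtain V where V: "conj_transpose V ** V = mat 1" "X = V ** X\<^sub>0"
      using unitary_transitive[OF X\<^sub>0] by (auto simp: space_\<mu>)
    have "(\<integral>\<^sup>+W. indicator B (orientation W ** X) * ennreal (gaussian_density W) \<partial>(lborel :: (complex ^ 'm ^ 'm) measure))
        = (\<integral>\<^sup>+W. indicator B (orientation (mat 1 ** W ** V) ** X\<^sub>0) * ennreal (gaussian_density W) \<partial>(lborel :: (complex ^ 'm ^ 'm) measure))"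
    proof (rule nn_integral_cong_AE)
      show "AE W in lborel. indicator B (orientation W ** X) * ennreal (gaussian_density W)
          = indicator B (orientation (mat 1 ** W ** V) ** X\<^sub>0) * ennreal (gaussian_density (W :: complex ^ 'm ^ 'm))"
        using AE_full_rank[where ?'r='m and ?'m='m, OF order_refl]
      proof eventually_elim
        case (elim W)
        then have "orientation (mat 1 ** W ** V) = mat 1 ** orientation W ** V"
          by (rule orientation_unitary(1)) (simp_all add: V(1))
        then show ?case
          by (simp add: V(2) matrix_mul_assoc)
      qed
    qed
    also have "\<dots> = ?c"
      by (rule nn_integral_gaussian_unitary) (simp_all add: V(1))
    finally show "(\<integral>\<^sup>+W. indicator B (orientation W ** X) * ennreal (gaussian_density W) \<partial>(lborel :: (complex ^ 'm ^ 'm) measure)) = ?c" .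
  qed
  also have "\<dots> = ?c"
    by (simp add: \<mu>.emeasure_space_1)
  finally show ?thesis .
qed

theorem stiefel_measure_eq_orientation_law:
  assumes r: "CARD('r) \<le> CARD('m)"
  shows "(stiefel_measure :: (complex ^ 'r ^ 'm) measure) = orientation_law"
  unfolding stiefel_measure_def
proof (rule the_equality)
  show inv: "invariant_stiefel_prob (orientation_law :: (complex ^ 'r ^ 'm) measure)"
    by (rule invariant_orientation_law[OF r])
  fix \<mu> :: "(complex ^ 'r ^ 'm) measure"
  assume \<mu>: "invariant_stiefel_prob \<mu>"
  obtain X :: "complex ^ 'r ^ 'm" where X: "X \<in> stiefel"
    using stiefel_nonempty[OF r] by blast
  have sets: "sets \<mu> = sets (restrict_space borel stiefel)"
    using \<mu> by (simp add: invariant_stiefel_prob_def)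
  show "\<mu> = orientation_law"
  proof (rule measure_eqI)
    fix B assume "B \<in> sets \<mu>"
    then show "emeasure \<mu> B = emeasure orientation_law B"
      using invariant_stiefel_prob_emeasure[OF \<mu> _ X] invariant_stiefel_prob_emeasure[OF inv _ X] sets by simp
  qed (simp add: sets)
qed

section \<open>Gaussian moments of determinants\<close>

lemma norm_det_le:
  fixes A :: "complex ^ 'n ^ 'n"
  shows "norm (det A) \<le> real (card {p. p permutes (UNIV :: 'n set)}) * norm A ^ CARD('n)"
proof -
  have "norm (det A) \<le> (\<Sum>p | p permutes (UNIV :: 'n set). norm A ^ CARD('n))"
    unfolding det_def
  proof (rule sum_norm_le)
    fix p
    have "norm (of_int (sign p) * (\<Prod>i\<in>UNIV. A $ i $ p i)) = (\<Prod>i\<in>UNIV. norm (A $ i $ p i))"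
      by (simp add: norm_mult sign_def flip: prod_norm)
    also have "\<dots> \<le> (\<Prod>i\<in>(UNIV :: 'n set). norm A)"
      by (intro prod_mono) (auto intro: order_trans[OF Finite_Cartesian_Product.norm_nth_le Finite_Cartesian_Product.norm_nth_le])
    finally show "norm (of_int (sign p) * (\<Prod>i\<in>UNIV. A $ i $ p i)) \<le> norm A ^ CARD('n)"
      by simp
  qed
  then show ?thesis
    by simp
qed

text \<open>From \<open>(y / n)\<^sup>n \<le> (1 + y / n)\<^sup>n \<le> exp y\<close>.\<close>

lemma power_le_exp: "y ^ n \<le> real n ^ n * exp y" if "0 \<le> y" for y :: real
proof (cases "n = 0")
  case False
  then have "y ^ n = real n ^ n * (y / real n) ^ n"
    by (simp add: power_divide)
  also have "\<dots> \<le> real n ^ n * (1 + y / real n) ^ n"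
    using that by (intro mult_left_mono power_mono) auto
  also have "\<dots> \<le> real n ^ n * exp y"
    using that False by (intro mult_left_mono exp_ge_one_plus_x_over_n_power_n) auto
  finally show ?thesis .
qed (use that in simp)

definition det_moment :: "'n::finite itself \<Rightarrow> nat \<Rightarrow> ennreal" where
  "det_moment _ k = (\<integral>\<^sup>+A. ennreal (exp (- (norm A)\<^sup>2) * norm (det A) ^ (2 * k)) \<partial>(lborel :: (complex ^ 'n ^ 'n) measure))"

text \<open>The determinant grows polynomially; half of the exponent of the Gaussian pays for it.\<close>

lemma det_moment_finite: "det_moment TYPE('n::finite) k \<noteq> \<infinity>"
proof -
  define c where "c = real (card {p. p permutes (UNIV :: 'n set)})"
  define N where "N = CARD('n) * k"
  define M where "M = c ^ (2 * k) * (2 ^ N * real N ^ N)"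
  have bound: "exp (- (norm A)\<^sup>2) * norm (det A) ^ (2 * k) \<le> M * exp (- (1 / sqrt 2 * norm A)\<^sup>2)" for A :: "complex ^ 'n ^ 'n"
  proof -
    define y where "y = (norm A)\<^sup>2 / 2"
    have "norm (det A) ^ (2 * k) \<le> (c * norm A ^ CARD('n)) ^ (2 * k)"
      unfolding c_def by (intro power_mono norm_det_le) simp
    also have "\<dots> = c ^ (2 * k) * ((norm A)\<^sup>2) ^ N"
      by (simp add: power_mult_distrib N_def flip: power_mult) (simp add: ac_simps)
    also have "((norm A)\<^sup>2) ^ N = 2 ^ N * y ^ N"
      by (simp add: y_def power_divide)
    also have "c ^ (2 * k) * (2 ^ N * y ^ N) \<le> c ^ (2 * k) * (2 ^ N * (real N ^ N * exp y))"
      by (intro mult_left_mono power_le_exp) (auto simp: y_def c_def)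
    also have "\<dots> = M * exp y"
      by (simp add: M_def)
    finally have "exp (- (norm A)\<^sup>2) * norm (det A) ^ (2 * k) \<le> exp (- (norm A)\<^sup>2) * (M * exp y)"
      by (intro mult_left_mono) auto
    also have "\<dots> = M * exp (- (norm A)\<^sup>2 + y)"
      by (simp only: exp_add mult_ac)
    also have "- (norm A)\<^sup>2 + y = - (1 / sqrt 2 * norm A)\<^sup>2"
      by (simp add: y_def power_mult_distrib power_divide)
    finally show ?thesis .
  qed
  have "0 \<le> M"
    by (simp add: M_def c_def)
  have "det_moment TYPE('n) k \<le> (\<integral>\<^sup>+A. ennreal (M * exp (- (1 / sqrt 2 * norm A)\<^sup>2)) \<partial>(lborel :: (complex ^ 'n ^ 'n) measure))"
    unfolding det_moment_def by (intro nn_integral_mono ennreal_leI bound)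
  also have "\<dots> = ennreal M * (\<integral>\<^sup>+A. ennreal (exp (- (1 / sqrt 2 * norm A)\<^sup>2)) \<partial>(lborel :: (complex ^ 'n ^ 'n) measure))"
    using \<open>0 \<le> M\<close> by (simp add: ennreal_mult nn_integral_cmult)
  also have "\<dots> < \<infinity>"
    by (subst nn_integral_gaussian_scaled) (simp_all add: ennreal_mult_less_top)
  finally show ?thesis
    by simp
qed

lemma det_moment_nonzero: "det_moment TYPE('n::finite) k \<noteq> 0"
proof
  assume "det_moment TYPE('n) k = 0"
  then have "AE A in (lborel :: (complex ^ 'n ^ 'n) measure). ennreal (exp (- (norm A)\<^sup>2) * norm (det A) ^ (2 * k)) = 0"
    unfolding det_moment_def by (subst (asm) nn_integral_0_iff_AE) simp_all
  with AE_nonsingular have "AE A in (lborel :: (complex ^ 'n ^ 'n) measure). False"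
  proof eventually_elim
    case (elim A)
    then have "0 < exp (- (norm A)\<^sup>2) * norm (det A) ^ (2 * k)"
      by simp
    with elim show False
      by (simp add: ennreal_eq_0_iff)
  qed
  then show False
    by (subst (asm) AE_iff_measurable[where N=UNIV]) (simp_all add: emeasure_lborel_UNIV)
qed

lemma det_moment_mult_left:
  fixes R :: "complex ^ 'n ^ 'n"
  assumes R: "det R \<noteq> 0"
  shows "(\<integral>\<^sup>+A. ennreal (exp (- (norm (R ** A))\<^sup>2) * norm (det A) ^ (2 * k)) \<partial>lborel)
    = ennreal (1 / norm (det R) ^ (2 * (CARD('n) + k))) * det_moment TYPE('n) k"
proof -
  let ?g = "\<lambda>A :: complex ^ 'n ^ 'n. exp (- (norm A)\<^sup>2) * norm (det A) ^ (2 * k)"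
  have "(\<integral>\<^sup>+A. ennreal (exp (- (norm (R ** A))\<^sup>2) * norm (det A) ^ (2 * k)) \<partial>lborel)
      = (\<integral>\<^sup>+A. ennreal (1 / norm (det R) ^ (2 * k)) * ennreal (?g (R ** A)) \<partial>lborel)"
    using R by (intro nn_integral_cong) (simp add: det_mul norm_mult power_mult_distrib flip: ennreal_mult)
  also have "\<dots> = ennreal (1 / norm (det R) ^ (2 * CARD('n))) * (\<integral>\<^sup>+A. ennreal (1 / norm (det R) ^ (2 * k)) * ennreal (?g A) \<partial>lborel)"
    by (rule nn_integral_lborel_mult_left[OF _ R]) simp
  also have "\<dots> = ennreal (1 / norm (det R) ^ (2 * CARD('n))) * (ennreal (1 / norm (det R) ^ (2 * k)) * det_moment TYPE('n) k)"
    by (subst nn_integral_cmult) (simp_all add: det_moment_def)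
  also have "\<dots> = ennreal (1 / norm (det R) ^ (2 * (CARD('n) + k))) * det_moment TYPE('n) k"
    by (simp add: power_add algebra_simps mult.assoc[symmetric] flip: ennreal_mult)
  finally show ?thesis .
qed

text \<open>Unlike \<^const>\<open>matrix_inv\<close>, whose value at singular matrices is an arbitrary choice, this is evidently a
  Borel function.\<close>

definition inv_or_zero :: "complex ^ 'n ^ 'n \<Rightarrow> complex ^ 'n ^ 'n" where
  "inv_or_zero A = (if det A = 0 then 0 else matrix_inv A)"

lemma inv_or_zero_measurable [measurable]: "inv_or_zero \<in> borel_measurable borel"
proof -
  have "closed {A :: complex ^ 'a ^ 'a. det A = 0}"
    by (intro closed_Collect_eq continuous_intros)
  then have "(\<lambda>A :: complex ^ 'a ^ 'a. if A \<in> {A. det A = 0} then 0 else matrix_inv A) \<in> borel_measurable borel"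
    by (intro borel_measurable_continuous_on_if borel_closed continuous_intros) auto
  then show ?thesis
    by (simp add: inv_or_zero_def[abs_def])
qed

text \<open>The weight that \<open>exp (- |Z|\<^sup>2)\<close> acquires under \<open>Z \<mapsto> Z A\<^sup>-\<^sup>1\<close>; it is integrated over \<open>A\<close>.\<close>

definition inv_kernel :: "nat \<Rightarrow> complex ^ 'n ^ 'm \<Rightarrow> complex ^ 'n ^ 'n \<Rightarrow> real" where
  "inv_kernel n Z A = exp (- (norm (Z ** inv_or_zero A))\<^sup>2) * inverse (norm (det A) ^ (2 * n))"

definition inv_det_moment :: "'n::finite itself \<Rightarrow> nat \<Rightarrow> ennreal" where
  "inv_det_moment _ n = (\<integral>\<^sup>+A. ennreal (inv_kernel n (mat 1) A) \<partial>(lborel :: (complex ^ 'n ^ 'n) measure))"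

text \<open>The substitution \<open>A = B R\<close>. Together with the previous moment it produces powers of the determinant
  of \<open>R\<close> from Gaussian integrals. The number of columns in the
  exponent is chosen to cancel the Jacobian.\<close>

lemma inv_det_moment_mult:
  fixes R :: "complex ^ 'n ^ 'n"
  assumes R: "det R \<noteq> 0"
  shows "(\<integral>\<^sup>+A. ennreal (inv_kernel (n + CARD('n)) R A) \<partial>lborel)
    = ennreal (1 / norm (det R) ^ (2 * n)) * inv_det_moment TYPE('n) (n + CARD('n))"
proof -
  let ?N = "n + CARD('n)"
  let ?d = "norm (det R)"
  have d: "?d > 0"
    using R by simp
  have [measurable]: "inv_kernel N X \<in> borel_measurable borel" for N and X :: "complex ^ 'n ^ 'n"
    unfolding inv_kernel_def[abs_def] by measurable
  have inv: "R ** inv_or_zero (B ** R) = inv_or_zero B" for B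
  proof (cases "det B = 0")
    case False
    have "B ** R ** (matrix_inv R ** matrix_inv B) = B ** (R ** matrix_inv R) ** matrix_inv B"
      by (simp only: matrix_mul_assoc)
    then have "matrix_inv (B ** R) = matrix_inv R ** matrix_inv B"
      using False R by (intro matrix_inv_eqI) (simp add: matrix_inv_mult)
    then show ?thesis
      using False R by (simp add: inv_or_zero_def det_mul matrix_mul_assoc matrix_inv_mult)
  qed (simp add: inv_or_zero_def det_mul)
  have "(\<integral>\<^sup>+B. ennreal (inv_kernel ?N R (B ** R)) \<partial>lborel) = (\<integral>\<^sup>+B. ennreal (1 / ?d ^ (2 * ?N)) * ennreal (inv_kernel ?N (mat 1 :: complex ^ 'n ^ 'n) B) \<partial>lborel)"
    by (intro nn_integral_cong) (simp add: inv_kernel_def inv det_mul norm_mult power_mult_distrib divide_inverse flip: ennreal_mult)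
  also have "\<dots> = ennreal (1 / ?d ^ (2 * ?N)) * inv_det_moment TYPE('n) ?N"
    unfolding inv_det_moment_def by (rule nn_integral_cmult) simp
  finally have "ennreal (1 / ?d ^ (2 * CARD('n))) * (\<integral>\<^sup>+A. ennreal (inv_kernel ?N R A) \<partial>lborel)
      = ennreal (1 / ?d ^ (2 * ?N)) * inv_det_moment TYPE('n) ?N"
    using nn_integral_lborel_mult_right[of "\<lambda>A. ennreal (inv_kernel ?N R A)" R] R by simp
  then have "ennreal (?d ^ (2 * CARD('n))) * (ennreal (1 / ?d ^ (2 * CARD('n))) * (\<integral>\<^sup>+A. ennreal (inv_kernel ?N R A) \<partial>lborel))
      = ennreal (?d ^ (2 * CARD('n))) * (ennreal (1 / ?d ^ (2 * ?N)) * inv_det_moment TYPE('n) ?N)"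
    by simp
  then show ?thesis
    using d by (simp add: mult.assoc[symmetric] power_add distrib_left flip: ennreal_mult)
qed

section \<open>Orientations under a change of covariance\<close>

lemma Re_det_gram_nonneg: "0 \<le> Re (det (conj_transpose Z ** Z))" for Z :: "complex ^ 'r ^ 'm"
  using det_hermitian_pos_def(2)[OF gram_pos_def, of Z] rank_eq_card_iff_det_gram[of Z]
  by (cases "rank Z = CARD('r)") auto

text \<open>Both sides are the double integral over \<open>Z\<close> and \<open>A\<close> of
  \<open>f(H\<^sub>Z) exp (- |Z|\<^sup>2) det (Z\<^sup>* Z)\<^sup>m exp (- |S Z A|\<^sup>2) |det A|\<^sup>2\<^sup>k\<close> with \<open>k = m - r\<close>. Integrating over \<open>A\<close> first gives
  \<open>det (Z\<^sup>* Q Z)\<^sup>-\<^sup>m\<close> up to a constant. Substituting \<open>Z A\<^sup>-\<^sup>1\<close> for \<open>Z\<close> first turns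
  \<open>exp (- |S Z A|\<^sup>2)\<close> into \<open>exp (- |S Z|\<^sup>2)\<close>, after which the integral over \<open>A\<close> gives
  \<open>det (Z\<^sup>* Z)\<^sup>-\<^sup>m\<close> up to a constant and cancels the determinant. The substitution changes the orientation
  by a unitary factor on the right, to which \<open>f\<close> is insensitive.\<close>

lemma unitary_invariant_identity:
  fixes f :: "complex ^ 'r ^ 'm \<Rightarrow> ennreal" and S :: "complex ^ 'm ^ 'm"
  assumes r: "CARD('r) \<le> CARD('m)" and f [measurable]: "f \<in> borel_measurable borel"
    and invariant: "\<And>X V. conj_transpose V ** V = mat 1 \<Longrightarrow> f (X ** V) = f X"
    and S: "det S \<noteq> 0"
  defines "Q \<equiv> conj_transpose S ** S"
  shows "det_moment TYPE('r) (CARD('m) - CARD('r)) *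
      (\<integral>\<^sup>+Z. f (orientation Z) * ennreal (exp (- (norm Z)\<^sup>2) *
          (Re (det (conj_transpose Z ** Z)) / Re (det (conj_transpose Z ** Q ** Z))) ^ CARD('m)) \<partial>lborel)
    = inv_det_moment TYPE('r) (CARD('m) + CARD('r)) *
      (\<integral>\<^sup>+Z. f (orientation Z) * ennreal (exp (- (norm (S ** Z))\<^sup>2)) \<partial>lborel)"
proof -
  define m where "m = CARD('m)"
  define k where "k = m - CARD('r)"
  have mk: "m = CARD('r) + k"
    using r by (simp add: k_def m_def)
  let ?D = "\<lambda>Z :: complex ^ 'r ^ 'm. Re (det (conj_transpose Z ** Z))"
  let ?DQ = "\<lambda>Z :: complex ^ 'r ^ 'm. Re (det (conj_transpose Z ** Q ** Z))"
  let ?J = "\<lambda>A Z. f (orientation Z) * ennreal (exp (- (norm Z)\<^sup>2) * ?D Z ^ m * (exp (- (norm (S ** Z ** A))\<^sup>2) * norm (det A) ^ (2 * k)))"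
  let ?K = "\<lambda>A Z. f (orientation Z) * ennreal (exp (- (norm (S ** Z))\<^sup>2) * ?D Z ^ m * inv_kernel (m + CARD('r)) Z A)"
  have Q: "hermitian_pos_def Q"
    unfolding Q_def using S by (intro gram_pos_def) (simp add: rank_eq_card_iff_det)
  have kernel_nonneg: "0 \<le> inv_kernel n Z A" for n Z and A :: "complex ^ 'r ^ 'r"
    by (simp add: inv_kernel_def)
  have "(\<integral>\<^sup>+A. \<integral>\<^sup>+Z. ?J A Z \<partial>lborel \<partial>lborel) = (\<integral>\<^sup>+Z. \<integral>\<^sup>+A. ?J A Z \<partial>lborel \<partial>lborel)"
    by (rule lborel_pair.Fubini') simp
  also have "\<dots> = (\<integral>\<^sup>+Z. f (orientation Z) * ennreal (exp (- (norm Z)\<^sup>2) * (?D Z / ?DQ Z) ^ m) * det_moment TYPE('r) k \<partial>lborel)"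
  proof (rule nn_integral_cong_AE)
    show "AE Z in lborel. (\<integral>\<^sup>+A. ?J A Z \<partial>lborel) = f (orientation Z) * ennreal (exp (- (norm Z)\<^sup>2) * (?D Z / ?DQ Z) ^ m) * det_moment TYPE('r) k"
      using AE_full_rank[OF r]
    proof eventually_elim
      case (elim Z)
      have K: "hermitian_pos_def (conj_transpose Z ** Q ** Z)"
        using elim Q by (rule gram_hermitian_pos_def)
      define R where "R = hermitian_sqrt (conj_transpose Z ** Q ** Z)"
      have detR: "det R \<noteq> 0"
        unfolding R_def using K by (rule det_hermitian_sqrt_nz)
      have "conj_transpose (S ** Z) ** (S ** Z) = conj_transpose Z ** Q ** Z"
        by (simp add: Q_def conj_transpose_mult matrix_mul_assoc)
      then have "conj_transpose (S ** Z) ** (S ** Z) = conj_transpose R ** R"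
        unfolding R_def conj_transpose_hermitian_sqrt[OF K] hermitian_sqrt(2)[OF K] .
      then have norm: "norm (S ** Z ** A) = norm (R ** A)" for A :: "complex ^ 'r ^ 'r"
        by (rule norm_mult_cong_gram)
      have "(\<integral>\<^sup>+A. ?J A Z \<partial>lborel)
          = (\<integral>\<^sup>+A. f (orientation Z) * ennreal (exp (- (norm Z)\<^sup>2) * ?D Z ^ m) * ennreal (exp (- (norm (R ** A))\<^sup>2) * norm (det A) ^ (2 * k)) \<partial>lborel)"
        by (intro nn_integral_cong) (simp add: norm ennreal_mult Re_det_gram_nonneg mult.assoc)
      also have "\<dots> = f (orientation Z) * ennreal (exp (- (norm Z)\<^sup>2) * ?D Z ^ m) * (ennreal (1 / norm (det R) ^ (2 * m)) * det_moment TYPE('r) k)"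
        by (subst nn_integral_cmult) (simp_all add: det_moment_mult_left[OF detR] mk)
      also have "norm (det R) ^ (2 * m) = ?DQ Z ^ m"
        unfolding R_def by (simp add: power_mult det_hermitian_pos_def(3)[OF K])
      also have "f (orientation Z) * ennreal (exp (- (norm Z)\<^sup>2) * ?D Z ^ m) * (ennreal (1 / ?DQ Z ^ m) * det_moment TYPE('r) k)
          = f (orientation Z) * (ennreal (exp (- (norm Z)\<^sup>2) * ?D Z ^ m) * ennreal (1 / ?DQ Z ^ m)) * det_moment TYPE('r) k"
        by (simp add: mult.assoc)
      also have "ennreal (exp (- (norm Z)\<^sup>2) * ?D Z ^ m) * ennreal (1 / ?DQ Z ^ m) = ennreal (exp (- (norm Z)\<^sup>2) * (?D Z / ?DQ Z) ^ m)"
        using det_hermitian_pos_def(2)[OF K] by (simp add: Re_det_gram_nonneg power_divide flip: ennreal_mult)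
      finally show ?case .
    qed
  qed
  also have "\<dots> = det_moment TYPE('r) k * (\<integral>\<^sup>+Z. f (orientation Z) * ennreal (exp (- (norm Z)\<^sup>2) * (?D Z / ?DQ Z) ^ m) \<partial>lborel)"
    by (subst nn_integral_multc) (simp_all add: mult.commute)
  finally have side1: "(\<integral>\<^sup>+A. \<integral>\<^sup>+Z. ?J A Z \<partial>lborel \<partial>lborel)
      = det_moment TYPE('r) k * (\<integral>\<^sup>+Z. f (orientation Z) * ennreal (exp (- (norm Z)\<^sup>2) * (?D Z / ?DQ Z) ^ m) \<partial>lborel)" .
  have [measurable]: "(\<lambda>x. inv_kernel n (g x) (h x)) \<in> borel_measurable M"
    if [measurable]: "g \<in> borel_measurable M" "h \<in> borel_measurable M" for M n and g :: "'x \<Rightarrow> complex ^ 'r ^ 'm" and h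
    unfolding inv_kernel_def by measurable
  have "(\<integral>\<^sup>+A. \<integral>\<^sup>+Z. ?J A Z \<partial>lborel \<partial>lborel) = (\<integral>\<^sup>+A. \<integral>\<^sup>+Z. ?K A Z \<partial>lborel \<partial>lborel)"
  proof (rule nn_integral_cong_AE)
    show "AE A in lborel. (\<integral>\<^sup>+Z. ?J A Z \<partial>lborel) = (\<integral>\<^sup>+Z. ?K A Z \<partial>lborel)"
      using AE_nonsingular
    proof eventually_elim
      case (elim A)
      define a where "a = norm (det A)"
      have a: "a > 0"
        using elim by (simp add: a_def)
      let ?B = "matrix_inv A"
      have detB: "det ?B \<noteq> 0" and normB: "norm (det ?B) = 1 / a"
        using elim by (simp_all add: det_matrix_inv norm_inverse a_def divide_inverse)
      have "(\<integral>\<^sup>+Z. ?J A (Z ** ?B) \<partial>lborel) = ennreal (a ^ (2 * m)) * (\<integral>\<^sup>+Z. ?J A Z \<partial>lborel)"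
        by (subst nn_integral_lborel_mult_right[of "?J A", OF _ detB]) (simp_all add: normB m_def power_divide)
      then have "ennreal (1 / a ^ (2 * m)) * (\<integral>\<^sup>+Z. ?J A (Z ** ?B) \<partial>lborel) = (\<integral>\<^sup>+Z. ?J A Z \<partial>lborel)"
        using a by (simp add: mult.assoc[symmetric] flip: ennreal_mult)
      then have "(\<integral>\<^sup>+Z. ?J A Z \<partial>lborel) = (\<integral>\<^sup>+Z. ennreal (1 / a ^ (2 * m)) * ?J A (Z ** ?B) \<partial>lborel)"
        by (subst nn_integral_cmult) simp_all
      also have "\<dots> = (\<integral>\<^sup>+Z. ?K A Z \<partial>lborel)"
      proof (rule nn_integral_cong_AE)
        show "AE Z in lborel. ennreal (1 / a ^ (2 * m)) * ?J A (Z ** ?B) = ?K A Z"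
          using AE_full_rank[OF r]
        proof eventually_elim
          case (elim Z)
          obtain V where V: "conj_transpose V ** V = mat 1" "orientation (Z ** ?B) = orientation Z ** V"
            using orientation_mult_right[OF elim detB] .
          have fV: "f (orientation (Z ** ?B)) = f (orientation Z)"
            by (simp add: V invariant)
          have SZ: "S ** (Z ** ?B) ** A = S ** Z"
            using matrix_inv_mult(2)[of A] \<open>det A \<noteq> 0\<close> by (simp flip: matrix_mul_assoc)
          have "conj_transpose (Z ** ?B) ** (Z ** ?B) = conj_transpose ?B ** (conj_transpose Z ** Z) ** ?B"
            by (simp add: conj_transpose_mult matrix_mul_assoc)
          then have "det (conj_transpose (Z ** ?B) ** (Z ** ?B)) = (cnj (det ?B) * det ?B) * det (conj_transpose Z ** Z)"
            by (simp add: det_mul det_conj_transpose)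
          also have "cnj (det ?B) * det ?B = of_real (1 / a\<^sup>2)"
            by (metis normB complex_norm_square mult.commute power_one_over)
          finally have DB: "?D (Z ** ?B) = ?D Z / a\<^sup>2"
            by simp
          have expo: "1 / a ^ (2 * m) * ((?D Z / a\<^sup>2) ^ m * a ^ (2 * k)) = ?D Z ^ m * inverse (a ^ (2 * (m + CARD('r))))"
          proof -
            have exponents: "a ^ (2 * m) * a ^ (2 * m) = a ^ (2 * (m + CARD('r))) * a ^ (2 * k)"
              by (simp add: mk flip: power_add) (simp add: algebra_simps)
            have "1 / a ^ (2 * m) * ((?D Z / a\<^sup>2) ^ m * a ^ (2 * k)) = ?D Z ^ m * a ^ (2 * k) / (a ^ (2 * m) * a ^ (2 * m))"
              by (simp add: power_divide power_mult)
            also have "\<dots> = ?D Z ^ m * inverse (a ^ (2 * (m + CARD('r))))"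
              unfolding exponents using a by (simp add: divide_inverse)
            finally show ?thesis .
          qed
          have "ennreal (1 / a ^ (2 * m)) * ?J A (Z ** ?B)
              = f (orientation Z) * ennreal (1 / a ^ (2 * m) * (exp (- (norm (Z ** ?B))\<^sup>2) * (?D Z / a\<^sup>2) ^ m * (exp (- (norm (S ** Z))\<^sup>2) * a ^ (2 * k))))"
            using a by (subst ennreal_mult) (simp_all add: fV SZ DB a_def Re_det_gram_nonneg mult_ac)
          also have "1 / a ^ (2 * m) * (exp (- (norm (Z ** ?B))\<^sup>2) * (?D Z / a\<^sup>2) ^ m * (exp (- (norm (S ** Z))\<^sup>2) * a ^ (2 * k)))
              = exp (- (norm (Z ** ?B))\<^sup>2) * exp (- (norm (S ** Z))\<^sup>2) * (1 / a ^ (2 * m) * ((?D Z / a\<^sup>2) ^ m * a ^ (2 * k)))"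
            by (simp add: mult_ac)
          also have "\<dots> = exp (- (norm (S ** Z))\<^sup>2) * ?D Z ^ m * inv_kernel (m + CARD('r)) Z A"
            unfolding expo using \<open>det A \<noteq> 0\<close> by (simp add: inv_kernel_def inv_or_zero_def a_def)
          finally show ?case .
        qed
      qed
      finally show ?case .
    qed
  qed
  also have "\<dots> = (\<integral>\<^sup>+Z. \<integral>\<^sup>+A. ?K A Z \<partial>lborel \<partial>lborel)"
    by (rule lborel_pair.Fubini') simp
  also have "\<dots> = (\<integral>\<^sup>+Z. f (orientation Z) * ennreal (exp (- (norm (S ** Z))\<^sup>2)) * inv_det_moment TYPE('r) (m + CARD('r)) \<partial>lborel)"
  proof (rule nn_integral_cong_AE)
    show "AE Z in lborel. (\<integral>\<^sup>+A. ?K A Z \<partial>lborel) = f (orientation Z) * ennreal (exp (- (norm (S ** Z))\<^sup>2)) * inv_det_moment TYPE('r) (m + CARD('r))"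
      using AE_full_rank[OF r]
    proof eventually_elim
      case (elim Z)
      note K = gram_pos_def[OF elim]
      define R where "R = hermitian_sqrt (conj_transpose Z ** Z)"
      have detR: "det R \<noteq> 0"
        unfolding R_def using K by (rule det_hermitian_sqrt_nz)
      have "conj_transpose Z ** Z = conj_transpose R ** R"
        using hermitian_sqrt[OF K] by (simp add: R_def conj_transpose_hermitian_sqrt[OF K])
      then have kernel: "inv_kernel n Z A = inv_kernel n R A" for n and A :: "complex ^ 'r ^ 'r"
        using norm_mult_cong_gram[of Z R "inv_or_zero A"] by (simp add: inv_kernel_def)
      have [measurable]: "inv_kernel N R \<in> borel_measurable borel" for N
        unfolding inv_kernel_def[abs_def] by measurable
      have "(\<integral>\<^sup>+A. ?K A Z \<partial>lborel)
          = (\<integral>\<^sup>+A. f (orientation Z) * ennreal (exp (- (norm (S ** Z))\<^sup>2) * ?D Z ^ m) * ennreal (inv_kernel (m + CARD('r)) R A) \<partial>lborel)"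
        by (intro nn_integral_cong) (simp add: kernel[symmetric] kernel_nonneg ennreal_mult Re_det_gram_nonneg mult.assoc)
      also have "\<dots> = f (orientation Z) * ennreal (exp (- (norm (S ** Z))\<^sup>2) * ?D Z ^ m) * (ennreal (1 / norm (det R) ^ (2 * m)) * inv_det_moment TYPE('r) (m + CARD('r)))"
        by (subst nn_integral_cmult) (simp_all add: inv_det_moment_mult[OF detR])
      also have "norm (det R) ^ (2 * m) = ?D Z ^ m"
        unfolding R_def by (simp add: power_mult det_hermitian_pos_def(3)[OF K])
      also have "f (orientation Z) * ennreal (exp (- (norm (S ** Z))\<^sup>2) * ?D Z ^ m) * (ennreal (1 / ?D Z ^ m) * inv_det_moment TYPE('r) (m + CARD('r)))
          = f (orientation Z) * (ennreal (exp (- (norm (S ** Z))\<^sup>2) * ?D Z ^ m) * ennreal (1 / ?D Z ^ m)) * inv_det_moment TYPE('r) (m + CARD('r))"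
        by (simp add: mult.assoc)
      also have "ennreal (exp (- (norm (S ** Z))\<^sup>2) * ?D Z ^ m) * ennreal (1 / ?D Z ^ m) = ennreal (exp (- (norm (S ** Z))\<^sup>2))"
        using det_hermitian_pos_def(2)[OF K] by (simp flip: ennreal_mult)
      finally show ?case .
    qed
  qed
  also have "\<dots> = inv_det_moment TYPE('r) (m + CARD('r)) * (\<integral>\<^sup>+Z. f (orientation Z) * ennreal (exp (- (norm (S ** Z))\<^sup>2)) \<partial>lborel)"
    by (subst nn_integral_multc) (simp_all add: mult.commute)
  finally show ?thesis
    using side1 by (simp add: k_def m_def)
qed

text \<open>The two constants are compared in the case \<open>f = 1\<close>, \<open>S = I\<close>, where both integrals are the total mass of
  the Gaussian weight.\<close>

lemma det_moment_eq_inv_det_moment: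
  assumes r: "CARD('r::finite) \<le> CARD('m::finite)"
  shows "inv_det_moment TYPE('r) (CARD('m) + CARD('r)) = det_moment TYPE('r) (CARD('m) - CARD('r))"
proof -
  let ?G = "\<integral>\<^sup>+Z. ennreal (exp (- (norm (Z :: complex ^ 'r ^ 'm))\<^sup>2)) \<partial>lborel"
  have G: "?G \<noteq> 0" "?G \<noteq> \<infinity>"
    unfolding nn_integral_gaussian by simp_all
  have "(\<integral>\<^sup>+Z. ennreal (exp (- (norm Z)\<^sup>2) *
          (Re (det (conj_transpose Z ** Z)) / Re (det (conj_transpose Z ** Z))) ^ CARD('m)) \<partial>(lborel :: (complex ^ 'r ^ 'm) measure)) = ?G"
  proof (rule nn_integral_cong_AE)
    show "AE Z in lborel. ennreal (exp (- (norm (Z :: complex ^ 'r ^ 'm))\<^sup>2) *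
          (Re (det (conj_transpose Z ** Z)) / Re (det (conj_transpose Z ** Z))) ^ CARD('m)) = ennreal (exp (- (norm Z)\<^sup>2))"
      using AE_full_rank[OF r] by eventually_elim (use det_hermitian_pos_def(2)[OF gram_pos_def] in fastforce)
  qed
  then have "det_moment TYPE('r) (CARD('m) - CARD('r)) * ?G = inv_det_moment TYPE('r) (CARD('m) + CARD('r)) * ?G"
    using unitary_invariant_identity[OF r, of "\<lambda>_. 1" "mat 1"] by simp
  from ennreal_mult_right_cancelD[OF this G] show ?thesis
    by (rule sym)
qed

text \<open>Averaging \<open>f\<close> over a random right translation changes no integral against a weight that
  is invariant under such translations.\<close>

lemma nn_integral_average_right:
  fixes f w :: "complex ^ 'r ^ 'm \<Rightarrow> ennreal"
  assumes r: "CARD('r) \<le> CARD('m)"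
    and [measurable]: "f \<in> borel_measurable borel" "w \<in> borel_measurable borel"
    and w: "\<And>Z V. conj_transpose V ** V = mat 1 \<Longrightarrow> w (Z ** V) = w Z"
  shows "(\<integral>\<^sup>+Z. (\<integral>\<^sup>+A. f (orientation Z ** orientation A) * ennreal (gaussian_density (A :: complex ^ 'r ^ 'r)) \<partial>lborel) * w Z \<partial>lborel)
    = (\<integral>\<^sup>+Z. f (orientation Z) * w Z \<partial>lborel)"
proof -
  have "(\<integral>\<^sup>+Z. (\<integral>\<^sup>+A. f (orientation Z ** orientation A) * ennreal (gaussian_density (A :: complex ^ 'r ^ 'r)) \<partial>lborel) * w Z \<partial>lborel)
      = (\<integral>\<^sup>+Z. \<integral>\<^sup>+A. f (orientation Z ** orientation A) * w Z * ennreal (gaussian_density (A :: complex ^ 'r ^ 'r)) \<partial>lborel \<partial>lborel)"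
    by (intro nn_integral_cong) (subst nn_integral_multc[symmetric], simp_all add: mult_ac)
  also have "\<dots> = (\<integral>\<^sup>+A. \<integral>\<^sup>+Z. f (orientation Z ** orientation A) * w Z * ennreal (gaussian_density (A :: complex ^ 'r ^ 'r)) \<partial>lborel \<partial>lborel)"
    by (rule lborel_pair.Fubini') simp
  also have "\<dots> = (\<integral>\<^sup>+A. (\<integral>\<^sup>+Z. f (orientation Z) * w Z \<partial>lborel) * ennreal (gaussian_density (A :: complex ^ 'r ^ 'r)) \<partial>lborel)"
  proof (rule nn_integral_cong)
    fix A :: "complex ^ 'r ^ 'r"
    have V: "conj_transpose (orientation A) ** orientation A = mat 1"
      using orientation_in_stiefel[of A] by (simp add: stiefel_def)
    have "(\<integral>\<^sup>+Z. f (orientation Z ** orientation A) * w Z \<partial>lborel)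
        = (\<integral>\<^sup>+Z. f (orientation (mat 1 ** Z ** orientation A)) * w (mat 1 ** Z ** orientation A) \<partial>lborel)"
    proof (rule nn_integral_cong_AE)
      show "AE Z in lborel. f (orientation Z ** orientation A) * w Z
          = f (orientation (mat 1 ** Z ** orientation A)) * w (mat 1 ** Z ** orientation A)"
        using AE_full_rank[OF r]
      proof eventually_elim
        case (elim Z)
        then have "orientation (mat 1 ** Z ** orientation A) = mat 1 ** orientation Z ** orientation A"
          by (rule orientation_unitary(1)) (simp_all add: V)
        then show ?case
          by (simp add: w V)
      qed
    qed
    also have "\<dots> = (\<integral>\<^sup>+Z. f (orientation Z) * w Z \<partial>lborel)"
      by (rule nn_integral_unitary[of "\<lambda>Z. f (orientation Z) * w Z"]) (simp_all add: V)
    finally show "(\<integral>\<^sup>+Z. f (orientation Z ** orientation A) * w Z * ennreal (gaussian_density A) \<partial>lborel)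
        = (\<integral>\<^sup>+Z. f (orientation Z) * w Z \<partial>lborel) * ennreal (gaussian_density A)"
      by (simp add: nn_integral_multc)
  qed
  also have "\<dots> = (\<integral>\<^sup>+Z. f (orientation Z) * w Z \<partial>lborel)"
    by (simp add: nn_integral_cmult nn_integral_gaussian_density)
  finally show ?thesis .
qed

text \<open>The averaged function is right invariant, because the random unitary matrix used for averaging has
  a left invariant law.\<close>

lemma average_right_invariant:
  fixes f :: "complex ^ 'r ^ 'm \<Rightarrow> ennreal"
  assumes [measurable]: "f \<in> borel_measurable borel" and V: "conj_transpose V ** V = mat 1"
  shows "(\<integral>\<^sup>+A. f (X ** V ** orientation A) * ennreal (gaussian_density (A :: complex ^ 'r ^ 'r)) \<partial>lborel)
    = (\<integral>\<^sup>+A. f (X ** orientation A) * ennreal (gaussian_density (A :: complex ^ 'r ^ 'r)) \<partial>lborel)"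
proof -
  have "(\<integral>\<^sup>+A. f (X ** V ** orientation A) * ennreal (gaussian_density (A :: complex ^ 'r ^ 'r)) \<partial>lborel)
    = (\<integral>\<^sup>+A. f (X ** orientation (V ** A ** mat 1)) * ennreal (gaussian_density (A :: complex ^ 'r ^ 'r)) \<partial>lborel)"
  proof (rule nn_integral_cong_AE)
    show "AE A in lborel. f (X ** V ** orientation A) * ennreal (gaussian_density (A :: complex ^ 'r ^ 'r))
        = f (X ** orientation (V ** A ** mat 1)) * ennreal (gaussian_density A)"
      using AE_full_rank[where ?'r='r and ?'m='r, OF order_refl]
    proof eventually_elim
      case (elim A)
      then have "orientation (V ** A ** mat 1) = V ** orientation A ** mat 1"
        by (rule orientation_unitary(1)) (simp_all add: V)
      then show ?case
        by (simp add: matrix_mul_assoc)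
    qed
  qed
  also have "\<dots> = (\<integral>\<^sup>+A. f (X ** orientation A) * ennreal (gaussian_density (A :: complex ^ 'r ^ 'r)) \<partial>lborel)"
    by (rule nn_integral_gaussian_unitary[of "\<lambda>A. f (X ** orientation A)"]) (simp_all add: V)
  finally show ?thesis .
qed

text \<open>The heart of the matter: passing from covariance \<open>Q\<^sup>-\<^sup>1\<close> to covariance \<open>I\<close> costs, as far as the
  orientation is concerned and up to normalization, the determinant ratio on the right, which is a function of the
  orientation alone. Both weights are right unitarily invariant, so \<open>f\<close> may be replaced by its average.\<close>

theorem orientation_change_of_covariance:
  fixes f :: "complex ^ 'r ^ 'm \<Rightarrow> ennreal" and S :: "complex ^ 'm ^ 'm"
  assumes r: "CARD('r) \<le> CARD('m)" and [measurable]: "f \<in> borel_measurable borel" and S: "det S \<noteq> 0"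
  defines "Q \<equiv> conj_transpose S ** S"
  shows "(\<integral>\<^sup>+Z. f (orientation Z) * ennreal (exp (- (norm (S ** Z))\<^sup>2)) \<partial>lborel)
    = (\<integral>\<^sup>+Z. f (orientation Z) * ennreal (exp (- (norm Z)\<^sup>2) *
          (Re (det (conj_transpose Z ** Z)) / Re (det (conj_transpose Z ** Q ** Z))) ^ CARD('m)) \<partial>lborel)"
proof -
  define g where "g X = (\<integral>\<^sup>+A. f (X ** orientation A) * ennreal (gaussian_density (A :: complex ^ 'r ^ 'r)) \<partial>lborel)" for X
  let ?w1 = "\<lambda>Z :: complex ^ 'r ^ 'm. ennreal (exp (- (norm (S ** Z))\<^sup>2))"
  let ?w2 = "\<lambda>Z :: complex ^ 'r ^ 'm. ennreal (exp (- (norm Z)\<^sup>2) *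
          (Re (det (conj_transpose Z ** Z)) / Re (det (conj_transpose Z ** Q ** Z))) ^ CARD('m))"
  have w1: "?w1 (Z ** V) = ?w1 Z" if "conj_transpose V ** V = mat 1" for Z V
    using norm_mult_right_unitary[OF that, of "S ** Z"] by (simp add: matrix_mul_assoc)
  have w2: "?w2 (Z ** V) = ?w2 Z" if V: "conj_transpose V ** V = mat 1" for Z V
  proof -
    have det: "det (conj_transpose (Z ** V) ** K ** (Z ** V)) = det (conj_transpose Z ** K ** Z)" for K
    proof -
      have "conj_transpose (Z ** V) ** K ** (Z ** V) = conj_transpose V ** (conj_transpose Z ** K ** Z) ** V"
        by (simp add: conj_transpose_mult matrix_mul_assoc)
      then have "det (conj_transpose (Z ** V) ** K ** (Z ** V)) = det (conj_transpose V ** V) * det (conj_transpose Z ** K ** Z)"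
        by (simp add: det_mul)
      then show ?thesis
        by (simp add: V)
    qed
    show ?thesis
      using det[of "mat 1"] by (simp add: det norm_mult_right_unitary[OF V])
  qed
  have [measurable]: "g \<in> borel_measurable borel"
    unfolding g_def by measurable
  have g: "g (X ** V) = g X" if "conj_transpose V ** V = mat 1" for X V
    unfolding g_def by (rule average_right_invariant[OF _ that]) simp
  have "det_moment TYPE('r) (CARD('m) - CARD('r)) * (\<integral>\<^sup>+Z. g (orientation Z) * ?w2 Z \<partial>lborel)
      = det_moment TYPE('r) (CARD('m) - CARD('r)) * (\<integral>\<^sup>+Z. g (orientation Z) * ?w1 Z \<partial>lborel)"
    using unitary_invariant_identity[OF r _ g S] unfolding det_moment_eq_inv_det_moment[OF r] Q_def by simp
  then have "(\<integral>\<^sup>+Z. g (orientation Z) * ?w2 Z \<partial>lborel) = (\<integral>\<^sup>+Z. g (orientation Z) * ?w1 Z \<partial>lborel)"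
    unfolding mult.commute[of "det_moment _ _"] by (rule ennreal_mult_right_cancelD) (rule det_moment_nonzero det_moment_finite)+
  moreover have "(\<integral>\<^sup>+Z. g (orientation Z) * ?w1 Z \<partial>lborel) = (\<integral>\<^sup>+Z. f (orientation Z) * ?w1 Z \<partial>lborel)"
    unfolding g_def by (rule nn_integral_average_right[OF r _ _ w1]) simp_all
  moreover have "(\<integral>\<^sup>+Z. g (orientation Z) * ?w2 Z \<partial>lborel) = (\<integral>\<^sup>+Z. f (orientation Z) * ?w2 Z \<partial>lborel)"
    unfolding g_def by (rule nn_integral_average_right[OF r _ _ w2]) simp_all
  ultimately show ?thesis
    by simp
qed

section \<open>The density of the orientation\<close>

lemma complex_normal_density_eq:
  fixes Z :: "complex ^ 'r ^ 'm"
  assumes P: "hermitian_pos_def P"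
  shows "complex_normal_density P Z = inverse (Re (det P) ^ CARD('r)) *
    (exp (- (norm (hermitian_sqrt (matrix_inv P) ** Z))\<^sup>2) / sqrt pi ^ DIM(complex ^ 'r ^ 'm))"
proof -
  let ?S = "hermitian_sqrt (matrix_inv P)"
  note Q = hermitian_pos_def_matrix_inv[OF P]
  have "(norm (?S ** Z))\<^sup>2 = Re (trace (conj_transpose Z ** (?S ** ?S) ** Z))"
    by (simp add: norm_matrix_conv_trace conj_transpose_mult conj_transpose_hermitian_sqrt[OF Q] matrix_mul_assoc)
  also have "?S ** ?S = matrix_inv P"
    by (rule hermitian_sqrt(2)[OF Q])
  finally have "Re (trace (conj_transpose Z ** matrix_inv P ** Z)) = (norm (?S ** Z))\<^sup>2" ..
  moreover have "sqrt pi ^ DIM(complex ^ 'r ^ 'm) = pi ^ (CARD('m) * CARD('r))"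
    by (simp add: power_mult[symmetric] mult.commute[of _ 2] mult.assoc[symmetric])
      (simp add: power_mult mult.assoc)
  ultimately show ?thesis
    by (simp add: complex_normal_density_def divide_inverse)
qed

theorem theorem3:
  fixes M :: "'a measure"
    and Z :: "'a \<Rightarrow> complex ^ 'r ^ 'm"
    and P :: "complex ^ 'm ^ 'm"
  assumes "CARD('r) \<le> CARD('m)"
    and "hermitian_pos_def P"
    and "prob_space M"
    and "distributed M lborel Z (\<lambda>z. ennreal (complex_normal_density P z))"
  shows "distributed M stiefel_measure (\<lambda>\<omega>. orientation (Z \<omega>))
           (\<lambda>H. ennreal (cmacg_density P H))"
proof -
  note r = assms(1) and P = assms(2) and Z = assms(4)
  define Q where "Q = matrix_inv P"
  define S where "S = hermitian_sqrt Q"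
  define p where "p = inverse (Re (det P) ^ CARD('r))"
  let ?L = "orientation_law :: (complex ^ 'r ^ 'm) measure"
  let ?H = "\<lambda>\<omega>. orientation (Z \<omega>)"
  have Q: "hermitian_pos_def Q"
    unfolding Q_def using P by (rule hermitian_pos_def_matrix_inv)
  have p: "0 \<le> p"
    using det_hermitian_pos_def(2)[OF P] by (simp add: p_def)
  have Z_measurable [measurable]: "Z \<in> measurable M borel"
    using distributed_measurable[OF Z] by simp
  have density_measurable [measurable]: "cmacg_density P \<in> borel_measurable (borel :: (complex ^ 'r ^ 'm) measure)"
    unfolding cmacg_density_def by measurable
  have H_measurable: "?H \<in> measurable M ?L"
    by (subst measurable_cong_sets[OF refl sets_orientation_law])
      (rule measurable_compose[OF Z_measurable orientation_measurable_stiefel[OF r refl]])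
  have density_measurable': "(\<lambda>H. ennreal (cmacg_density P H)) \<in> borel_measurable ?L"
    by (subst measurable_cong_sets[OF sets_orientation_law refl]) (rule measurable_restrict_space1, measurable)
  have "distr M ?L ?H = density ?L (\<lambda>H. ennreal (cmacg_density P H))"
  proof (rule measure_eqI)
    fix B assume "B \<in> sets (distr M ?L ?H)"
    then have B: "B \<in> sets ?L"
      by simp
    then have [measurable]: "B \<in> sets borel"
      by (simp add: sets_stiefel_iff)
    let ?G = "sqrt pi ^ DIM(complex ^ 'r ^ 'm)"
    have "emeasure (distr M ?L ?H) B = (\<integral>\<^sup>+X. indicator B X \<partial>distr M ?L ?H)"
      using B by simp
    also have "\<dots> = (\<integral>\<^sup>+\<omega>. indicator B (?H \<omega>) \<partial>M)"
      using B by (intro nn_integral_distr H_measurable borel_measurable_indicator) simp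
    also have "\<dots> = (\<integral>\<^sup>+z. ennreal (complex_normal_density P z) * indicator B (orientation z) \<partial>lborel)"
      by (rule distributed_nn_integral[OF Z, symmetric]) simp
    also have "\<dots> = (\<integral>\<^sup>+z. ennreal (p / ?G) * (indicator B (orientation z) * ennreal (exp (- (norm (S ** z))\<^sup>2))) \<partial>lborel)"
    proof (rule nn_integral_cong)
      fix z :: "complex ^ 'r ^ 'm"
      have "ennreal (complex_normal_density P z) = ennreal (p / ?G) * ennreal (exp (- (norm (S ** z))\<^sup>2))"
        using p by (simp add: complex_normal_density_eq[OF P] p_def S_def Q_def flip: ennreal_mult)
      then show "ennreal (complex_normal_density P z) * indicator B (orientation z)
          = ennreal (p / ?G) * (indicator B (orientation z) * ennreal (exp (- (norm (S ** z))\<^sup>2)))"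
        by (simp add: mult_ac)
    qed
    also have "\<dots> = ennreal (p / ?G) * (\<integral>\<^sup>+z. indicator B (orientation z) * ennreal (exp (- (norm (S ** z))\<^sup>2)) \<partial>lborel)"
      by (rule nn_integral_cmult) simp
    also have "(\<integral>\<^sup>+z. indicator B (orientation z) * ennreal (exp (- (norm (S ** z))\<^sup>2)) \<partial>lborel)
        = (\<integral>\<^sup>+z. indicator B (orientation z) * ennreal (exp (- (norm z)\<^sup>2) *
          (Re (det (conj_transpose z ** z)) / Re (det (conj_transpose z ** (conj_transpose S ** S) ** z))) ^ CARD('m)) \<partial>lborel)"
      by (rule orientation_change_of_covariance[OF r]) (simp_all add: S_def det_hermitian_sqrt_nz[OF Q])
    also have "conj_transpose S ** S = Q"
      by (simp add: S_def conj_transpose_hermitian_sqrt[OF Q] hermitian_sqrt(2)[OF Q])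
    also have "ennreal (p / ?G) * (\<integral>\<^sup>+z. indicator B (orientation z) * ennreal (exp (- (norm z)\<^sup>2) *
          (Re (det (conj_transpose z ** z)) / Re (det (conj_transpose z ** Q ** z))) ^ CARD('m)) \<partial>lborel)
        = (\<integral>\<^sup>+z. ennreal (p / ?G) * (indicator B (orientation z) * ennreal (exp (- (norm z)\<^sup>2) *
          (Re (det (conj_transpose z ** z)) / Re (det (conj_transpose z ** Q ** z))) ^ CARD('m))) \<partial>lborel)"
      by (rule nn_integral_cmult[symmetric]) simp
    also have "\<dots> = (\<integral>\<^sup>+z. ennreal (cmacg_density P (orientation z)) * indicator B (orientation z) * ennreal (gaussian_density z) \<partial>lborel)"
    proof (rule nn_integral_cong_AE)
      show "AE z in lborel. ennreal (p / ?G) * (indicator B (orientation z) * ennreal (exp (- (norm z)\<^sup>2) *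
          (Re (det (conj_transpose z ** z)) / Re (det (conj_transpose z ** Q ** z))) ^ CARD('m)))
        = ennreal (cmacg_density P (orientation z)) * indicator B (orientation z) * ennreal (gaussian_density z)"
        using AE_full_rank[OF r]
      proof eventually_elim
        case (elim z)
        let ?q = "Re (det (conj_transpose z ** z)) / Re (det (conj_transpose z ** Q ** z))"
        have q: "0 \<le> ?q"
          using det_hermitian_pos_def(2)[OF gram_hermitian_pos_def[OF elim Q]] Re_det_gram_nonneg[of z] by simp
        have "cmacg_density P (orientation z) = p * ?q ^ CARD('m)"
          using det_orientation_gram[OF elim Q] by (simp add: cmacg_density_def p_def Q_def power_divide)
        then have "ennreal (p / ?G) * ennreal (exp (- (norm z)\<^sup>2) * ?q ^ CARD('m)) = ennreal (cmacg_density P (orientation z)) * ennreal (gaussian_density z)"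
          using p q by (simp add: gaussian_density_def mult_ac flip: ennreal_mult)
        then show ?case
          by (simp add: mult_ac)
      qed
    qed
    also have "\<dots> = (\<integral>\<^sup>+X. ennreal (cmacg_density P X) * indicator B X \<partial>?L)"
      by (rule nn_integral_orientation_law[OF r, symmetric]) simp
    also have "\<dots> = emeasure (density ?L (\<lambda>H. ennreal (cmacg_density P H))) B"
      using B density_measurable' by (simp add: emeasure_density)
    finally show "emeasure (distr M ?L ?H) B = emeasure (density ?L (\<lambda>H. ennreal (cmacg_density P H))) B" .
  qed simp
  then show ?thesis
    using H_measurable density_measurable' by (simp add: distributed_def stiefel_measure_eq_orientation_law[OF r])
qed

end
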